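(* Let $p$ be a prime and let $k$ be a field of characteristic $p$. The truncated polynomial algebra $k[x]/(x^p)$ (viewed as a $k$-category with one object) does not admit a universal covering.
   Context: A $k$-category is a small category $\mathcal B$ whose morphism sets are $k$-vector spaces with $k$-bilinear composition. It is connected if any two objects are joined by a non-zero walk, i.e. a finite composable sequence $(f_n,\epsilon_n)\cdots(f_1,\epsilon_1)$ of non-zero morphisms with signs $\epsilon_i=\pm1$ (sign $-1$ exchanges source and target). The star $\mathsf{St}_b\mathcal B$ is the direct sum of all morphism spaces with source $b$ and all morphism spaces with target $b$. A covering is a $k$-functor $F:\mathcal C\to\mathcal B$, surjective on objects, inducing an isomorphism $\mathsf{St}_x\mathcal C\to\mathsf{St}_b\mathcal B$ for each object $b$ of $\mathcal B$ and each $x\in F^{-1}(b)$. $\mathsf{Aut}_1F$ is the group of invertible endofunctors $G$ of $\mathcal C$ with $FG=F$. $F$ is a Galois covering if $\mathcal C$ is connected and $\mathsf{Aut}_1F$ acts transitively on some fibre. A morphism of coverings from $F:\mathcal C\to\mathcal B$ to $G:\mathcal D\to\mathcal B$ is a pair $(H,J)$ of $k$-linear functors $H:\mathcal C\to\mathcal D$, $J:\mathcal B\to\mathcal B$ with $J$ an isomorphism that is the identity on objects and $GH=JF$. A universal covering of $\mathcal B$ is a Galois covering $U:\mathcal U\to\mathcal B$ such that for any Galois covering $F:\mathcal C\to\mathcal B$ and any objects $u_0$ of $\mathcal U$, $c_0$ of $\mathcal C$ with $U(u_0)=F(c_0)$, there is a unique morphism $(H,1)$ from $U$ to $F$ with $H(u_0)=c_0$.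 *)

theory Defs
  imports "HOL-Algebra.Algebra"
begin

section \<open>Categories enriched in vector spaces\<close>

text \<open>
  The morphism spaces form a family indexed by pairs of objects; they are not required to be
  disjoint, so that maps on morphisms carry source and target as arguments. Of the records
  \<open>Hom C x y\<close> only carrier, zero, addition and scalar multiplication are
  meaningful; their ring multiplication and unit are ignored.
\<close>

record ('a, 'o, 'm) kcat =
  Ob :: "'o set"
  Hom :: "'o \<Rightarrow> 'o \<Rightarrow> ('a, 'm) module"
  Comp :: "'o \<Rightarrow> 'o \<Rightarrow> 'o \<Rightarrow> 'm \<Rightarrow> 'm \<Rightarrow> 'm"
    \<comment> \<open>\<open>Comp C x y z g f\<close> is \<open>g \<circ> f\<close> for \<open>f : x \<rightarrow> y\<close> and \<open>g : y \<rightarrow> z\<close>\<close>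
  Ident :: "'o \<Rightarrow> 'm"

locale k_category = field k
  for k :: "('a, 's) ring_scheme" and C :: "('a, 'o, 'm) kcat" +
  assumes hom_module: "\<lbrakk>x \<in> Ob C; y \<in> Ob C\<rbrakk> \<Longrightarrow> module k (Hom C x y)"
    and comp_closed: "\<lbrakk>x \<in> Ob C; y \<in> Ob C; z \<in> Ob C; f \<in> carrier (Hom C x y); g \<in> carrier (Hom C y z)\<rbrakk>
      \<Longrightarrow> Comp C x y z g f \<in> carrier (Hom C x z)"
    and ident_closed: "x \<in> Ob C \<Longrightarrow> Ident C x \<in> carrier (Hom C x x)"
    and comp_assoc: "\<lbrakk>w \<in> Ob C; x \<in> Ob C; y \<in> Ob C; z \<in> Ob C;
        f \<in> carrier (Hom C w x); g \<in> carrier (Hom C x y); h \<in> carrier (Hom C y z)\<rbrakk>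
      \<Longrightarrow> Comp C w y z h (Comp C w x y g f) = Comp C w x z (Comp C x y z h g) f"
    and comp_ident_left: "\<lbrakk>x \<in> Ob C; y \<in> Ob C; f \<in> carrier (Hom C x y)\<rbrakk>
      \<Longrightarrow> Comp C x y y (Ident C y) f = f"
    and comp_ident_right: "\<lbrakk>x \<in> Ob C; y \<in> Ob C; f \<in> carrier (Hom C x y)\<rbrakk>
      \<Longrightarrow> Comp C x x y f (Ident C x) = f"
    and comp_add_left: "\<lbrakk>x \<in> Ob C; y \<in> Ob C; z \<in> Ob C; f \<in> carrier (Hom C x y);
        g \<in> carrier (Hom C y z); g' \<in> carrier (Hom C y z)\<rbrakk>
      \<Longrightarrow> Comp C x y z (g \<oplus>\<^bsub>Hom C y z\<^esub> g') f
          = Comp C x y z g f \<oplus>\<^bsub>Hom C x z\<^esub> Comp C x y z g' f"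
    and comp_add_right: "\<lbrakk>x \<in> Ob C; y \<in> Ob C; z \<in> Ob C; f \<in> carrier (Hom C x y);
        f' \<in> carrier (Hom C x y); g \<in> carrier (Hom C y z)\<rbrakk>
      \<Longrightarrow> Comp C x y z g (f \<oplus>\<^bsub>Hom C x y\<^esub> f')
          = Comp C x y z g f \<oplus>\<^bsub>Hom C x z\<^esub> Comp C x y z g f'"
    and comp_smult_left: "\<lbrakk>x \<in> Ob C; y \<in> Ob C; z \<in> Ob C; a \<in> carrier k;
        f \<in> carrier (Hom C x y); g \<in> carrier (Hom C y z)\<rbrakk>
      \<Longrightarrow> Comp C x y z (a \<odot>\<^bsub>Hom C y z\<^esub> g) f = a \<odot>\<^bsub>Hom C x z\<^esub> Comp C x y z g f"
    and comp_smult_right: "\<lbrakk>x \<in> Ob C; y \<in> Ob C; z \<in> Ob C; a \<in> carrier k;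
        f \<in> carrier (Hom C x y); g \<in> carrier (Hom C y z)\<rbrakk>
      \<Longrightarrow> Comp C x y z g (a \<odot>\<^bsub>Hom C x y\<^esub> f) = a \<odot>\<^bsub>Hom C x z\<^esub> Comp C x y z g f"


section \<open>Connectedness\<close>

text \<open>
  A step \<open>(x, y, f, \<epsilon>)\<close> of a walk is a morphism \<open>f : x \<rightarrow> y\<close> with a sign,
  \<open>True\<close> for \<open>+1\<close> and \<open>False\<close> for \<open>-1\<close>. A walk is a list of steps in the order in which they are
  traversed, that is, in the reverse of the order of composition.
\<close>

fun step_source :: "'o \<times> 'o \<times> 'm \<times> bool \<Rightarrow> 'o" where
  "step_source (x, y, f, \<epsilon>) = (if \<epsilon> then x else y)"

fun step_target :: "'o \<times> 'o \<times> 'm \<times> bool \<Rightarrow> 'o" where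
  "step_target (x, y, f, \<epsilon>) = (if \<epsilon> then y else x)"

definition nonzero_steps :: "('a, 'o, 'm) kcat \<Rightarrow> ('o \<times> 'o \<times> 'm \<times> bool) set" where
  "nonzero_steps C =
    {(x, y, f, \<epsilon>). x \<in> Ob C \<and> y \<in> Ob C \<and> f \<in> carrier (Hom C x y) \<and> f \<noteq> \<zero>\<^bsub>Hom C x y\<^esub>}"

definition nonzero_walk :: "('a, 'o, 'm) kcat \<Rightarrow> 'o \<Rightarrow> 'o \<Rightarrow> ('o \<times> 'o \<times> 'm \<times> bool) list \<Rightarrow> bool" where
  "nonzero_walk C x y w \<longleftrightarrow>
    w \<noteq> [] \<and> set w \<subseteq> nonzero_steps C \<and> successively (\<lambda>s t. step_target s = step_source t) w \<and>
    step_source (hd w) = x \<and> step_target (last w) = y"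

definition connected_kcat :: "('a, 'o, 'm) kcat \<Rightarrow> bool" where
  "connected_kcat C \<longleftrightarrow> (\<forall>x\<in>Ob C. \<forall>y\<in>Ob C. \<exists>w. nonzero_walk C x y w)"


section \<open>Linear functors\<close>

record ('o, 'm, 'o2, 'm2) kfun =
  FOb :: "'o \<Rightarrow> 'o2"
  FHom :: "'o \<Rightarrow> 'o \<Rightarrow> 'm \<Rightarrow> 'm2"

definition linear_map_on :: "('a, 's) ring_scheme \<Rightarrow> ('a, 'm) module \<Rightarrow> ('a, 'n) module \<Rightarrow> ('m \<Rightarrow> 'n) \<Rightarrow> bool" where
  "linear_map_on k M N h \<longleftrightarrow>
    h \<in> carrier M \<rightarrow> carrier N \<and>
    (\<forall>u\<in>carrier M. \<forall>v\<in>carrier M. h (u \<oplus>\<^bsub>M\<^esub> v) = h u \<oplus>\<^bsub>N\<^esub> h v) \<and>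
    (\<forall>a\<in>carrier k. \<forall>u\<in>carrier M. h (a \<odot>\<^bsub>M\<^esub> u) = a \<odot>\<^bsub>N\<^esub> h u)"

text \<open>
  Functors are required to be extensional, i.e. to take the value \<^term>\<open>undefined\<close> outside
  objects and morphisms of the source category. Hence equality of functors in the sense of
  category theory is equality in HOL.
\<close>

locale k_functor = C: k_category k C + D: k_category k D
  for k :: "('a, 's) ring_scheme" and C :: "('a, 'o, 'm) kcat" and D :: "('a, 'o2, 'm2) kcat"
    and F :: "('o, 'm, 'o2, 'm2) kfun" +
  assumes fob_closed: "FOb F \<in> Ob C \<rightarrow>\<^sub>E Ob D"
    and fhom_linear: "\<lbrakk>x \<in> Ob C; y \<in> Ob C\<rbrakk>
      \<Longrightarrow> linear_map_on k (Hom C x y) (Hom D (FOb F x) (FOb F y)) (FHom F x y)"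
    and fhom_ident: "x \<in> Ob C \<Longrightarrow> FHom F x x (Ident C x) = Ident D (FOb F x)"
    and fhom_comp: "\<lbrakk>x \<in> Ob C; y \<in> Ob C; z \<in> Ob C; f \<in> carrier (Hom C x y); g \<in> carrier (Hom C y z)\<rbrakk>
      \<Longrightarrow> FHom F x z (Comp C x y z g f)
          = Comp D (FOb F x) (FOb F y) (FOb F z) (FHom F y z g) (FHom F x y f)"
    and fhom_ext: "\<not> (x \<in> Ob C \<and> y \<in> Ob C \<and> f \<in> carrier (Hom C x y)) \<Longrightarrow> FHom F x y f = undefined"

definition id_kfun :: "('a, 'o, 'm) kcat \<Rightarrow> ('o, 'm, 'o, 'm) kfun" where
  "id_kfun C =
    \<lparr>FOb = (\<lambda>x\<in>Ob C. x),
     FHom = (\<lambda>x y f. if x \<in> Ob C \<and> y \<in> Ob C \<and> f \<in> carrier (Hom C x y) then f else undefined)\<rparr>"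

text \<open>\<open>comp_kfun C G F\<close> is \<open>G \<circ> F\<close>, where \<open>C\<close> is the source of \<open>F\<close>.\<close>

definition comp_kfun ::
  "('a, 'o, 'm) kcat \<Rightarrow> ('o2, 'm2, 'o3, 'm3) kfun \<Rightarrow> ('o, 'm, 'o2, 'm2) kfun \<Rightarrow> ('o, 'm, 'o3, 'm3) kfun" where
  "comp_kfun C G F =
    \<lparr>FOb = (\<lambda>x\<in>Ob C. FOb G (FOb F x)),
     FHom = (\<lambda>x y f. if x \<in> Ob C \<and> y \<in> Ob C \<and> f \<in> carrier (Hom C x y)
                     then FHom G (FOb F x) (FOb F y) (FHom F x y f) else undefined)\<rparr>"

definition k_isomorphism ::
  "('a, 's) ring_scheme \<Rightarrow> ('a, 'o, 'm) kcat \<Rightarrow> ('a, 'o2, 'm2) kcat \<Rightarrow> ('o, 'm, 'o2, 'm2) kfun \<Rightarrow> bool" where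
  "k_isomorphism k C D F \<longleftrightarrow>
    k_functor k C D F \<and>
    (\<exists>G. k_functor k D C G \<and> comp_kfun C G F = id_kfun C \<and> comp_kfun D F G = id_kfun D)"


section \<open>Stars and coverings\<close>

text \<open>
  The ring multiplication and unit of the direct sum are the pointwise ones; they are irrelevant,
  and only there because \<^typ>\<open>('a, 'm) module\<close> extends the type of ring records.
\<close>

definition direct_sum :: "'i set \<Rightarrow> ('i \<Rightarrow> ('a, 'm) module) \<Rightarrow> ('a, 'i \<Rightarrow> 'm) module" where
  "direct_sum I M =
    \<lparr>carrier = {s \<in> (\<Pi>\<^sub>E i\<in>I. carrier (M i)). finite {i \<in> I. s i \<noteq> \<zero>\<^bsub>M i\<^esub>}},
     monoid.mult = (\<lambda>s t. \<lambda>i\<in>I. s i \<otimes>\<^bsub>M i\<^esub> t i), one = (\<lambda>i\<in>I. \<one>\<^bsub>M i\<^esub>),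
     ring.zero = (\<lambda>i\<in>I. \<zero>\<^bsub>M i\<^esub>), ring.add = (\<lambda>s t. \<lambda>i\<in>I. s i \<oplus>\<^bsub>M i\<^esub> t i),
     smult = (\<lambda>a s. \<lambda>i\<in>I. a \<odot>\<^bsub>M i\<^esub> s i)\<rparr>"

text \<open>
  The summand of the star at \<open>b\<close> with index \<open>Inl y\<close> consists of the morphisms
  \<open>b \<rightarrow> y\<close>, the one with index \<open>Inr y\<close> of the morphisms \<open>y \<rightarrow> b\<close>. In particular the
  endomorphisms of \<open>b\<close> occur twice.
\<close>

definition star :: "('a, 'o, 'm) kcat \<Rightarrow> 'o \<Rightarrow> ('a, 'o + 'o \<Rightarrow> 'm) module" where
  "star C b = direct_sum (Inl ` Ob C \<union> Inr ` Ob C) (case_sum (\<lambda>y. Hom C b y) (\<lambda>y. Hom C y b))"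

text \<open>
  The map \<open>St\<^sub>x C \<rightarrow> St\<^sub>b B\<close>, \<open>b = F x\<close>, induced by \<open>F\<close> sends the summand \<open>C(x,y)\<close> to
  \<open>B(b, F y)\<close> and \<open>C(y,x)\<close> to \<open>B(F y, b)\<close>. The sums below range over the support of \<open>s\<close> because
  the fibres of \<open>F\<close> can be infinite, and \<^const>\<open>finsum\<close> over an infinite set is zero.
\<close>

definition star_map ::
  "('a, 'o, 'm) kcat \<Rightarrow> ('a, 'o2, 'm2) kcat \<Rightarrow> ('o, 'm, 'o2, 'm2) kfun \<Rightarrow> 'o \<Rightarrow> ('o + 'o \<Rightarrow> 'm) \<Rightarrow> ('o2 + 'o2 \<Rightarrow> 'm2)" where
  "star_map C B F x s =
    (\<lambda>i\<in>Inl ` Ob B \<union> Inr ` Ob B. case i of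
        Inl c \<Rightarrow> finsum (Hom B (FOb F x) c) (\<lambda>y. FHom F x y (s (Inl y)))
                  {y \<in> Ob C. FOb F y = c \<and> s (Inl y) \<noteq> \<zero>\<^bsub>Hom C x y\<^esub>}
      | Inr c \<Rightarrow> finsum (Hom B c (FOb F x)) (\<lambda>y. FHom F y x (s (Inr y)))
                  {y \<in> Ob C. FOb F y = c \<and> s (Inr y) \<noteq> \<zero>\<^bsub>Hom C y x\<^esub>})"

definition fibre :: "('a, 'o, 'm) kcat \<Rightarrow> ('o, 'm, 'o2, 'm2) kfun \<Rightarrow> 'o2 \<Rightarrow> 'o set" where
  "fibre C F b = {x \<in> Ob C. FOb F x = b}"

definition covering ::
  "('a, 's) ring_scheme \<Rightarrow> ('a, 'o, 'm) kcat \<Rightarrow> ('a, 'o2, 'm2) kcat \<Rightarrow> ('o, 'm, 'o2, 'm2) kfun \<Rightarrow> bool" where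
  "covering k C B F \<longleftrightarrow>
    k_functor k C B F \<and> FOb F ` Ob C = Ob B \<and>
    (\<forall>b\<in>Ob B. \<forall>x\<in>fibre C F b.
      linear_map_on k (star C x) (star B b) (star_map C B F x) \<and>
      bij_betw (star_map C B F x) (carrier (star C x)) (carrier (star B b)))"

definition Aut1 ::
  "('a, 's) ring_scheme \<Rightarrow> ('a, 'o, 'm) kcat \<Rightarrow> ('o, 'm, 'o2, 'm2) kfun \<Rightarrow> ('o, 'm, 'o, 'm) kfun set" where
  "Aut1 k C F = {G. k_isomorphism k C C G \<and> comp_kfun C F G = F}"

definition galois_covering ::
  "('a, 's) ring_scheme \<Rightarrow> ('a, 'o, 'm) kcat \<Rightarrow> ('a, 'o2, 'm2) kcat \<Rightarrow> ('o, 'm, 'o2, 'm2) kfun \<Rightarrow> bool" where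
  "galois_covering k C B F \<longleftrightarrow>
    covering k C B F \<and> connected_kcat C \<and>
    (\<exists>b\<in>Ob B. \<forall>x\<in>fibre C F b. \<forall>y\<in>fibre C F b. \<exists>G\<in>Aut1 k C F. FOb G x = y)"

definition covering_morphism ::
  "('a, 's) ring_scheme \<Rightarrow> ('a, 'o2, 'm2) kcat \<Rightarrow>
   ('a, 'o, 'm) kcat \<Rightarrow> ('o, 'm, 'o2, 'm2) kfun \<Rightarrow> ('a, 'o3, 'm3) kcat \<Rightarrow> ('o3, 'm3, 'o2, 'm2) kfun \<Rightarrow>
   ('o, 'm, 'o3, 'm3) kfun \<times> ('o2, 'm2, 'o2, 'm2) kfun \<Rightarrow> bool" where
  "covering_morphism k B C F D G = (\<lambda>(H, J).
    k_functor k C D H \<and> k_isomorphism k B B J \<and> (\<forall>b\<in>Ob B. FOb J b = b) \<and>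
    comp_kfun C G H = comp_kfun C J F)"

text \<open>
  The universal property refers to all Galois coverings of \<open>B\<close>. Since HOL does not quantify over
  types, the types \<open>'o\<close> and \<open>'m\<close> of the objects and morphisms of the covering categories are
  parameters. They play the role of the universe in which small categories live, and are
  independent of the types used for the category of the universal covering itself.

  A universe contains all Galois coverings of \<open>B\<close> up to isomorphism as soon as it has enough objects
  and \<open>'m\<close> is at least as large as the morphism spaces of \<open>B\<close>: a covering is injective
  on each morphism space. If \<open>B\<close> has one object and finite-dimensional endomorphism algebra, each
  object of a connected covering has only finitely many neighbours, so countably many objects
  suffice and \<open>'o\<close> only has to be infinite.
\<close>

definition universal_covering ::
  "'o itself \<Rightarrow> 'm itself \<Rightarrow> ('a, 's) ring_scheme \<Rightarrow>
   ('a, 'u, 'n) kcat \<Rightarrow> ('a, 'o2, 'm2) kcat \<Rightarrow> ('u, 'n, 'o2, 'm2) kfun \<Rightarrow> bool" where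
  "universal_covering _ _ k U B P \<longleftrightarrow>
    galois_covering k U B P \<and>
    (\<forall>(C :: ('a, 'o, 'm) kcat) F. galois_covering k C B F \<longrightarrow>
      (\<forall>u\<in>Ob U. \<forall>c\<in>Ob C. FOb P u = FOb F c \<longrightarrow>
        (\<exists>!H. covering_morphism k B U P C F (H, id_kfun B) \<and> FOb H u = c)))"


section \<open>Truncated polynomial algebras\<close>

text \<open>The additive order of the unit, with \<open>0\<close> standing for infinite order.\<close>

definition characteristic :: "('a, 's) ring_scheme \<Rightarrow> nat" where
  "characteristic R = group.ord (add_monoid R) \<one>\<^bsub>R\<^esub>"

text \<open>The \<open>k\<close>-algebra \<open>k[x]/(x\<^sup>n)\<close>; a scalar acts as multiplication by the class of the constant polynomial.\<close>

definition truncated_poly :: "('a, 's) ring_scheme \<Rightarrow> nat \<Rightarrow> ('a, 'a list set) module" where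
  "truncated_poly k n =
    (let P = univ_poly k (carrier k);
         I = PIdl\<^bsub>P\<^esub> (X\<^bsub>k\<^esub> [^]\<^bsub>P\<^esub> n);
         Q = P Quot I
     in \<lparr>carrier = carrier Q, monoid.mult = monoid.mult Q, one = \<one>\<^bsub>Q\<^esub>, ring.zero = \<zero>\<^bsub>Q\<^esub>, ring.add = ring.add Q,
         smult = (\<lambda>a u. (I +>\<^bsub>P\<^esub> ring.poly_of_const k a) \<otimes>\<^bsub>Q\<^esub> u)\<rparr>)"

definition one_object_kcat :: "('a, 'm) module \<Rightarrow> ('a, unit, 'm) kcat" where
  "one_object_kcat A =
    \<lparr>Ob = {()}, Hom = (\<lambda>_ _. A), Comp = (\<lambda>_ _ _ g f. g \<otimes>\<^bsub>A\<^esub> f), Ident = (\<lambda>_. \<one>\<^bsub>A\<^esub>)\<rparr>"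

end

theory Submission
  imports Defs
begin

text \<open>
  Write \<open>A = k[x]/(x\<^sup>p)\<close>. A grading of \<open>A\<close> by a finite group \<open>G\<close> with nonzero components yields a
  Galois covering of \<open>A\<close>, the smash product: its objects are the elements of \<open>G\<close>, and the
  morphisms \<open>g \<rightarrow> h\<close> are the homogeneous elements of degree \<open>h g\<^sup>-\<^sup>1\<close> (\<open>smash_proj_galois\<close>). If \<open>A\<close>
  had a universal covering, it would map to each of these coverings over \<open>A\<close>. The image in \<open>A\<close> of
  every morphism of the universal covering would then be homogeneous for every such grading
  (\<open>universal_covering_homogeneous\<close>).

  In characteristic \<open>p\<close> there are two gradings by the integers modulo \<open>p\<close> which have too little in
  common. One has the components \<open>k x\<^sup>i\<close>. The other has the components \<open>k (1 + x)\<^sup>j\<close>; it exists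
  because \<open>(1 + x)\<^sup>p = 1\<close> (\<open>power_basis_one_plus_xi\<close>). For \<open>i > 0\<close> the elements of \<open>k x\<^sup>i\<close> are
  nilpotent, while the nonzero elements of \<open>k (1 + x)\<^sup>j\<close> are units, so only scalars are
  homogeneous for both (\<open>common_homogeneous_is_scalar\<close>).

  On the other hand, surjectivity on stars makes the images of the morphisms of any covering span
  \<open>A\<close> (\<open>covering_image_spans\<close>). Hence a universal covering would force \<open>A\<close> to consist of scalars,
  although \<open>x\<close> is not one, as \<open>p \<ge> 2\<close>.
\<close>

section \<open>Graded algebras\<close>

lemma (in algebra) smult_mult_right:
  assumes "a \<in> carrier R" "u \<in> carrier M" "v \<in> carrier M"
  shows "u \<otimes>\<^bsub>M\<^esub> (a \<odot>\<^bsub>M\<^esub> v) = a \<odot>\<^bsub>M\<^esub> (u \<otimes>\<^bsub>M\<^esub> v)"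
  using smult_assoc2[OF assms(1,3,2)] assms by (simp add: m_comm)

text \<open>
  Besides the axioms of a grading, every homogeneous component is required to be nonzero: it is
  what makes any two objects of the category built from the grading joined by a single nonzero
  morphism.
\<close>

locale graded_algebra = algebra k A + K: field k + G: group G
  for k :: "('a, 's) ring_scheme" and A :: "('a, 'm) module" and G :: "'g monoid" +
  fixes V :: "'g \<Rightarrow> 'm set"
  assumes finite_group: "finite (carrier G)"
    and piece: "g \<in> carrier G \<Longrightarrow> submodule (V g) k A"
    and piece_nonzero: "g \<in> carrier G \<Longrightarrow> \<exists>u\<in>V g. u \<noteq> \<zero>\<^bsub>A\<^esub>"
    and one_piece: "\<one>\<^bsub>A\<^esub> \<in> V \<one>\<^bsub>G\<^esub>"
    and mult_piece: "\<lbrakk>g \<in> carrier G; h \<in> carrier G; u \<in> V g; v \<in> V h\<rbrakk> \<Longrightarrow> u \<otimes>\<^bsub>A\<^esub> v \<in> V (g \<otimes>\<^bsub>G\<^esub> h)"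
    and decomposition: "u \<in> carrier A \<Longrightarrow> \<exists>t\<in>(\<Pi> g\<in>carrier G. V g). u = finsum A t (carrier G)"
    and independent: "\<lbrakk>t \<in> (\<Pi> g\<in>carrier G. V g); finsum A t (carrier G) = \<zero>\<^bsub>A\<^esub>; g \<in> carrier G\<rbrakk>
      \<Longrightarrow> t g = \<zero>\<^bsub>A\<^esub>"
begin

lemma piece_simps:
  assumes "g \<in> carrier G"
  shows piece_subset: "V g \<subseteq> carrier A"
    and piece_zero: "\<zero>\<^bsub>A\<^esub> \<in> V g"
    and piece_add: "\<lbrakk>u \<in> V g; v \<in> V g\<rbrakk> \<Longrightarrow> u \<oplus>\<^bsub>A\<^esub> v \<in> V g"
    and piece_minus: "u \<in> V g \<Longrightarrow> \<ominus>\<^bsub>A\<^esub> u \<in> V g"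
    and piece_smult: "\<lbrakk>a \<in> carrier k; u \<in> V g\<rbrakk> \<Longrightarrow> a \<odot>\<^bsub>A\<^esub> u \<in> V g"
proof -
  interpret W: submodule "V g" k A using piece[OF assms] .
  show "V g \<subseteq> carrier A" using W.subset by simp
  show "\<zero>\<^bsub>A\<^esub> \<in> V g" using W.one_closed by simp
  show "\<lbrakk>u \<in> V g; v \<in> V g\<rbrakk> \<Longrightarrow> u \<oplus>\<^bsub>A\<^esub> v \<in> V g" using W.m_closed by simp
  show "u \<in> V g \<Longrightarrow> \<ominus>\<^bsub>A\<^esub> u \<in> V g" using W.m_inv_closed by (simp add: a_inv_def)
  show "\<lbrakk>a \<in> carrier k; u \<in> V g\<rbrakk> \<Longrightarrow> a \<odot>\<^bsub>A\<^esub> u \<in> V g" using W.smult_closed by simp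
qed

lemma piece_carrier: "\<lbrakk>g \<in> carrier G; u \<in> V g\<rbrakk> \<Longrightarrow> u \<in> carrier A"
  using piece_subset by blast

text \<open>
  The morphisms out of a fixed object and those into it are indexed by objects rather than by
  degrees, and in two different ways. Transporting the decomposition along a bijection \<open>\<pi>\<close> covers
  both.
\<close>

lemma decomposition_reindex:
  assumes \<pi>: "bij_betw \<pi> Y (carrier G)" and u: "u \<in> carrier A"
  shows "\<exists>t\<in>(\<Pi> y\<in>Y. V (\<pi> y)). u = finsum A t Y"
proof -
  from decomposition[OF u] obtain t where t: "t \<in> (\<Pi> g\<in>carrier G. V g)" "u = finsum A t (carrier G)"
    by blast
  have "finsum A t (carrier G) = finsum A (\<lambda>y. t (\<pi> y)) Y"
  proof -
    have "t \<in> \<pi> ` Y \<rightarrow> carrier A"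
      using t(1) \<pi> piece_carrier unfolding bij_betw_def by blast
    then show ?thesis using M.add.finprod_reindex[of t \<pi> Y] \<pi> unfolding bij_betw_def by simp
  qed
  moreover have "(\<lambda>y. t (\<pi> y)) \<in> (\<Pi> y\<in>Y. V (\<pi> y))"
    using t(1) \<pi> by (auto simp: bij_betw_def)
  ultimately show ?thesis using t(2) by auto
qed

lemma decomposition_unique:
  assumes \<pi>: "bij_betw \<pi> Y (carrier G)"
    and t: "t \<in> (\<Pi> y\<in>Y. V (\<pi> y))" and t': "t' \<in> (\<Pi> y\<in>Y. V (\<pi> y))"
    and eq: "finsum A t Y = finsum A t' Y" and y: "y \<in> Y"
  shows "t y = t' y"
proof -
  define \<rho> where "\<rho> = inv_into Y \<pi>"
  define d where "d = (\<lambda>g. t (\<rho> g) \<ominus>\<^bsub>A\<^esub> t' (\<rho> g))"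
  have \<pi>Y: "\<pi> y \<in> carrier G" if "y \<in> Y" for y using \<pi> that by (auto simp: bij_betw_def)
  have \<rho>: "bij_betw \<rho> (carrier G) Y" unfolding \<rho>_def using \<pi> by (rule bij_betw_inv_into)
  have \<pi>\<rho>: "\<pi> (\<rho> g) = g" "\<rho> g \<in> Y" if "g \<in> carrier G" for g
    using \<pi> that \<rho> unfolding \<rho>_def by (auto simp: bij_betw_def f_inv_into_f)
  have \<rho>\<pi>: "\<rho> (\<pi> y) = y" unfolding \<rho>_def using \<pi> y by (simp add: bij_betw_def)
  have mem: "t (\<rho> g) \<in> V g" "t' (\<rho> g) \<in> V g" if "g \<in> carrier G" for g
    using t t' \<pi>\<rho>[OF that] by (force simp: Pi_def)+
  have c: "t (\<rho> g) \<in> carrier A" "t' (\<rho> g) \<in> carrier A" if "g \<in> carrier G" for g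
    using mem[OF that] piece_carrier[OF that] by auto
  have cY: "t y \<in> carrier A" "t' y \<in> carrier A" if "y \<in> Y" for y
    using t t' that piece_carrier[OF \<pi>Y[OF that]] by auto
  have re: "finsum A (\<lambda>g. s (\<rho> g)) (carrier G) = finsum A s Y" if "s \<in> Y \<rightarrow> carrier A" for s
    using M.add.finprod_reindex[of s \<rho> "carrier G"] \<rho> that by (simp add: bij_betw_def)
  have d1: "d g \<in> V g" if "g \<in> carrier G" for g
    unfolding d_def a_minus_def using mem[OF that] piece_add[OF that] piece_minus[OF that] by blast
  have cd: "d g \<in> carrier A" if "g \<in> carrier G" for g
    using d1[OF that] piece_carrier[OF that] by auto
  have "finsum A (\<lambda>g. t (\<rho> g)) (carrier G) = finsum A (\<lambda>g. d g \<oplus>\<^bsub>A\<^esub> t' (\<rho> g)) (carrier G)"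
    by (rule M.add.finprod_cong') (auto simp: c cd d_def M.add.inv_solve_right a_minus_def M.a_assoc M.l_neg)
  also have "\<dots> = finsum A d (carrier G) \<oplus>\<^bsub>A\<^esub> finsum A (\<lambda>g. t' (\<rho> g)) (carrier G)"
    by (rule M.add.finprod_multf) (auto simp: c cd)
  finally have "finsum A t' Y = finsum A d (carrier G) \<oplus>\<^bsub>A\<^esub> finsum A t' Y"
    using re[of t] re[of t'] cY eq by auto
  moreover have "finsum A t' Y \<in> carrier A" "finsum A d (carrier G) \<in> carrier A"
    using cY cd by (auto intro!: M.add.finprod_closed)
  ultimately have "finsum A d (carrier G) = \<zero>\<^bsub>A\<^esub>"
    by (metis M.add.l_cancel_one' M.a_comm)
  then have "d (\<pi> y) = \<zero>\<^bsub>A\<^esub>"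
    using independent[of d "\<pi> y"] d1 \<pi>Y[OF y] by auto
  then show ?thesis unfolding d_def \<rho>\<pi> using cY[OF y] r_right_minus_eq by blast
qed

end

section \<open>The covering given by a grading\<close>

lemma one_object_k_category:
  assumes "algebra k A" "field k"
  shows "k_category k (one_object_kcat A)"
proof -
  interpret algebra k A by fact
  interpret K: field k by fact
  show ?thesis
    unfolding one_object_kcat_def
    by (intro k_category.intro k_category_axioms.intro)
      (simp_all add: K.field_axioms module m_assoc l_distr r_distr smult_assoc2 smult_mult_right)
qed

text \<open>
  The objects of the covering are the elements of \<open>G\<close>, and a morphism \<open>g \<rightarrow> h\<close> is an element of \<open>A\<close>
  that is homogeneous of degree \<open>h g\<^sup>-\<^sup>1\<close>. The universal property tests coverings whose objects
  and morphisms are taken from prescribed types; the injections \<open>ob\<close> and \<open>mor\<close> carry the category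
  over to such types.
\<close>

locale smash_product = graded_algebra k A G V
  for k :: "('a, 's) ring_scheme" and A :: "('a, 'm) module" and G :: "'g monoid" and V +
  fixes ob :: "'g \<Rightarrow> 'o" and mor :: "'m \<Rightarrow> 'n"
  assumes ob_inj: "inj_on ob (carrier G)" and mor_inj: "inj_on mor (carrier A)"
begin

abbreviation "Obs \<equiv> ob ` carrier G"

definition idx :: "'o \<Rightarrow> 'g" where "idx = inv_into (carrier G) ob"

definition val :: "'n \<Rightarrow> 'm" where "val = inv_into (carrier A) mor"

text \<open>
  The target comes first, so that the degree of a composite \<open>v \<circ> u\<close> is the degree of \<open>v\<close> times
  that of \<open>u\<close>, in the order in which the product \<open>v u\<close> is formed in \<open>A\<close>.
\<close>

definition deg :: "'o \<Rightarrow> 'o \<Rightarrow> 'g" where "deg x y = idx y \<otimes>\<^bsub>G\<^esub> inv\<^bsub>G\<^esub> (idx x)"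

definition smash_hom :: "'o \<Rightarrow> 'o \<Rightarrow> ('a, 'n) module" where
  "smash_hom x y =
    \<lparr>carrier = mor ` V (deg x y), monoid.mult = (\<lambda>_ _. mor \<zero>\<^bsub>A\<^esub>), one = mor \<zero>\<^bsub>A\<^esub>,
     ring.zero = mor \<zero>\<^bsub>A\<^esub>, ring.add = (\<lambda>u v. mor (val u \<oplus>\<^bsub>A\<^esub> val v)),
     smult = (\<lambda>a u. mor (a \<odot>\<^bsub>A\<^esub> val u))\<rparr>"

definition smash_cat :: "('a, 'o, 'n) kcat" where
  "smash_cat =
    \<lparr>Ob = Obs, Hom = smash_hom, Comp = (\<lambda>_ _ _ g f. mor (val g \<otimes>\<^bsub>A\<^esub> val f)), Ident = (\<lambda>_. mor \<one>\<^bsub>A\<^esub>)\<rparr>"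

definition smash_proj :: "('o, 'n, unit, 'm) kfun" where
  "smash_proj =
    \<lparr>FOb = (\<lambda>x\<in>Obs. ()),
     FHom = (\<lambda>x y f. if x \<in> Obs \<and> y \<in> Obs \<and> f \<in> carrier (smash_hom x y) then val f else undefined)\<rparr>"

text \<open>
  Right translation of \<open>G\<close>. It preserves the degrees \<open>h g\<^sup>-\<^sup>1\<close>, so it can leave the elements of
  \<open>A\<close> that serve as morphisms unchanged.
\<close>

definition translate :: "'g \<Rightarrow> ('o, 'n, 'o, 'n) kfun" where
  "translate g =
    \<lparr>FOb = (\<lambda>x\<in>Obs. ob (idx x \<otimes>\<^bsub>G\<^esub> g)),
     FHom = (\<lambda>x y f. if x \<in> Obs \<and> y \<in> Obs \<and> f \<in> carrier (smash_hom x y) then f else undefined)\<rparr>"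

lemma val_mor [simp]: "u \<in> carrier A \<Longrightarrow> val (mor u) = u"
  unfolding val_def using mor_inj by simp

lemma idx_ob [simp]: "g \<in> carrier G \<Longrightarrow> idx (ob g) = g"
  unfolding idx_def using ob_inj by simp

lemma idx_closed [simp]: "x \<in> Obs \<Longrightarrow> idx x \<in> carrier G"
  by auto

lemma ob_idx [simp]: "x \<in> Obs \<Longrightarrow> ob (idx x) = x"
  by auto

lemma deg_closed [simp]: "\<lbrakk>x \<in> Obs; y \<in> Obs\<rbrakk> \<Longrightarrow> deg x y \<in> carrier G"
  unfolding deg_def by (simp del: image_iff)

lemma deg_self: "x \<in> Obs \<Longrightarrow> deg x x = \<one>\<^bsub>G\<^esub>"
  unfolding deg_def by (simp del: image_iff)

lemma deg_trans:
  assumes "x \<in> Obs" "y \<in> Obs" "z \<in> Obs"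
  shows "deg y z \<otimes>\<^bsub>G\<^esub> deg x y = deg x z"
  using assms[THEN idx_closed] unfolding deg_def
  by (simp add: G.m_assoc G.inv_solve_left')

lemma deg_translate:
  assumes "x \<in> Obs" "y \<in> Obs" "g \<in> carrier G"
  shows "deg (ob (idx x \<otimes>\<^bsub>G\<^esub> g)) (ob (idx y \<otimes>\<^bsub>G\<^esub> g)) = deg x y"
proof -
  have c: "idx x \<in> carrier G" "idx y \<in> carrier G" using assms(1,2)[THEN idx_closed] .
  have "g \<otimes>\<^bsub>G\<^esub> (inv\<^bsub>G\<^esub> g \<otimes>\<^bsub>G\<^esub> inv\<^bsub>G\<^esub> idx x) = inv\<^bsub>G\<^esub> idx x"
    using c assms(3) by (simp add: G.m_assoc[symmetric])
  then show ?thesis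
    using c assms(3) unfolding deg_def by (simp add: G.inv_mult_group G.m_assoc)
qed

lemma bij_deg_target:
  assumes "x \<in> Obs" shows "bij_betw (deg x) Obs (carrier G)"
proof (rule bij_betw_byWitness[where f' = "\<lambda>g. ob (g \<otimes>\<^bsub>G\<^esub> idx x)"])
  have c: "idx x \<in> carrier G" using assms by (rule idx_closed)
  show "\<forall>y\<in>Obs. ob (deg x y \<otimes>\<^bsub>G\<^esub> idx x) = y"
    using c unfolding deg_def by (auto simp: G.m_assoc)
  show "\<forall>g\<in>carrier G. deg x (ob (g \<otimes>\<^bsub>G\<^esub> idx x)) = g"
    using c unfolding deg_def by (auto simp: G.m_assoc)
qed (use assms in \<open>auto simp: deg_closed\<close>)

lemma bij_deg_source:
  assumes "x \<in> Obs" shows "bij_betw (\<lambda>y. deg y x) Obs (carrier G)"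
proof (rule bij_betw_byWitness[where f' = "\<lambda>g. ob (inv\<^bsub>G\<^esub> g \<otimes>\<^bsub>G\<^esub> idx x)"])
  have c: "idx x \<in> carrier G" using assms by (rule idx_closed)
  show "\<forall>y\<in>Obs. ob (inv\<^bsub>G\<^esub> (deg y x) \<otimes>\<^bsub>G\<^esub> idx x) = y"
    using c unfolding deg_def by (auto simp: G.m_assoc G.inv_mult_group)
  show "\<forall>g\<in>carrier G. deg (ob (inv\<^bsub>G\<^esub> g \<otimes>\<^bsub>G\<^esub> idx x)) x = g"
    using c unfolding deg_def by (auto simp: G.m_assoc[symmetric] G.inv_mult_group)
qed (use assms in \<open>auto simp: deg_closed\<close>)

lemma smash_hom_simps [simp]:
  "carrier (smash_hom x y) = mor ` V (deg x y)"
  "\<zero>\<^bsub>smash_hom x y\<^esub> = mor \<zero>\<^bsub>A\<^esub>"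
  "u \<oplus>\<^bsub>smash_hom x y\<^esub> v = mor (val u \<oplus>\<^bsub>A\<^esub> val v)"
  "a \<odot>\<^bsub>smash_hom x y\<^esub> u = mor (a \<odot>\<^bsub>A\<^esub> val u)"
  unfolding smash_hom_def by simp_all

lemma smash_cat_simps [simp]:
  "Ob smash_cat = Obs" "Hom smash_cat = smash_hom"
  "Comp smash_cat x y z g f = mor (val g \<otimes>\<^bsub>A\<^esub> val f)" "Ident smash_cat x = mor \<one>\<^bsub>A\<^esub>"
  unfolding smash_cat_def by simp_all

lemma val_hom:
  assumes "x \<in> Obs" "y \<in> Obs" "f \<in> mor ` V (deg x y)"
  shows "val f \<in> V (deg x y)" "val f \<in> carrier A" "mor (val f) = f"
proof -
  obtain u where u: "u \<in> V (deg x y)" "f = mor u" using assms(3) by blast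
  with piece_carrier[OF deg_closed[OF assms(1,2)]] have "u \<in> carrier A" by blast
  with u show "val f \<in> V (deg x y)" "val f \<in> carrier A" "mor (val f) = f" by auto
qed

lemma smash_hom_module:
  assumes "x \<in> Obs" "y \<in> Obs"
  shows "module k (smash_hom x y)"
proof (rule moduleI)
  note d = deg_closed[OF assms]
  note c = piece_carrier[OF d]
  show "cring k" ..
  show "abelian_group (smash_hom x y)"
  proof (rule abelian_groupI)
    fix u assume "u \<in> carrier (smash_hom x y)"
    then obtain u' where u': "u' \<in> V (deg x y)" "u = mor u'" by auto
    then show "\<exists>v\<in>carrier (smash_hom x y). v \<oplus>\<^bsub>smash_hom x y\<^esub> u = \<zero>\<^bsub>smash_hom x y\<^esub>"
      using piece_minus[OF d, of u'] c by (auto simp: M.l_neg intro!: bexI[of _ "\<ominus>\<^bsub>A\<^esub> u'"])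
  qed (use c piece_add[OF d] piece_zero[OF d] in \<open>auto simp: M.a_ac\<close>)
qed (use piece_smult[OF deg_closed[OF assms]] piece_add[OF deg_closed[OF assms]] piece_carrier[OF deg_closed[OF assms]] in
    \<open>auto simp: smult_l_distr smult_r_distr smult_assoc1 smult_closed\<close>)

lemma comp_piece:
  assumes "x \<in> Obs" "y \<in> Obs" "z \<in> Obs" "u \<in> V (deg x y)" "v \<in> V (deg y z)"
  shows "v \<otimes>\<^bsub>A\<^esub> u \<in> V (deg x z)"
  using mult_piece[OF _ _ assms(5,4)] deg_trans[OF assms(1-3)] assms by simp

lemma smash_cat_k_category: "k_category k smash_cat"
proof (intro k_category.intro k_category_axioms.intro)
  show "field k" ..
next
  fix x y assume "x \<in> Ob smash_cat" "y \<in> Ob smash_cat"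
  then show "module k (Hom smash_cat x y)" using smash_hom_module by simp
next
  fix x y z f g
  assume "x \<in> Ob smash_cat" "y \<in> Ob smash_cat" "z \<in> Ob smash_cat"
    "f \<in> carrier (Hom smash_cat x y)" "g \<in> carrier (Hom smash_cat y z)"
  then show "Comp smash_cat x y z g f \<in> carrier (Hom smash_cat x z)"
    using comp_piece[of x y z "val f" "val g"] val_hom by simp
next
  fix x assume "x \<in> Ob smash_cat"
  then show "Ident smash_cat x \<in> carrier (Hom smash_cat x x)"
    using one_piece deg_self by simp
qed (simp_all add: val_hom m_assoc l_distr r_distr smult_assoc2 smult_mult_right del: image_iff)

lemma smash_proj_simps [simp]:
  "x \<in> Obs \<Longrightarrow> FOb smash_proj x = ()"
  "\<lbrakk>x \<in> Obs; y \<in> Obs; f \<in> mor ` V (deg x y)\<rbrakk> \<Longrightarrow> FHom smash_proj x y f = val f"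
  unfolding smash_proj_def by simp_all

lemma smash_proj_k_functor: "k_functor k smash_cat (one_object_kcat A) smash_proj"
proof -
  interpret C: k_category k smash_cat by (rule smash_cat_k_category)
  interpret B: k_category k "one_object_kcat A"
    by (rule one_object_k_category) unfold_locales
  show ?thesis
  proof unfold_locales
    show "FOb smash_proj \<in> Ob smash_cat \<rightarrow>\<^sub>E Ob (one_object_kcat A)"
      by (auto simp: smash_proj_def one_object_kcat_def)
  next
    fix x y assume "x \<in> Ob smash_cat" "y \<in> Ob smash_cat"
    then show "linear_map_on k (Hom smash_cat x y) (Hom (one_object_kcat A) (FOb smash_proj x) (FOb smash_proj y))
      (FHom smash_proj x y)"
      using piece_add[OF deg_closed, of x y] piece_smult[OF deg_closed, of x y] piece_carrier[OF deg_closed, of x y]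
      by (auto simp: linear_map_on_def one_object_kcat_def val_hom simp del: image_iff)
  next
    fix x assume "x \<in> Ob smash_cat"
    then show "FHom smash_proj x x (Ident smash_cat x) = Ident (one_object_kcat A) (FOb smash_proj x)"
      using one_piece deg_self by (simp add: one_object_kcat_def)
  next
    fix x y z f g
    assume *: "x \<in> Ob smash_cat" "y \<in> Ob smash_cat" "z \<in> Ob smash_cat"
      "f \<in> carrier (Hom smash_cat x y)" "g \<in> carrier (Hom smash_cat y z)"
    then have "mor (val g \<otimes>\<^bsub>A\<^esub> val f) \<in> mor ` V (deg x z)"
      using comp_piece[of x y z "val f" "val g"] val_hom by simp
    then show "FHom smash_proj x z (Comp smash_cat x y z g f) =
      Comp (one_object_kcat A) (FOb smash_proj x) (FOb smash_proj y) (FOb smash_proj z)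
        (FHom smash_proj y z g) (FHom smash_proj x y f)"
      using * val_hom by (simp add: one_object_kcat_def)
  qed (auto simp: smash_proj_def)
qed

abbreviation "star_index \<equiv> Inl ` Obs \<union> Inr ` Obs"
abbreviation "base_index \<equiv> Inl ` {()} \<union> Inr ` {()}"
abbreviation "star_proj \<equiv> star_map smash_cat (one_object_kcat A) smash_proj"

lemma mem_star_iff:
  "s \<in> carrier (star smash_cat x) \<longleftrightarrow> s \<in> extensional star_index \<and>
    (\<forall>y\<in>Obs. s (Inl y) \<in> mor ` V (deg x y) \<and> s (Inr y) \<in> mor ` V (deg y x))"
  using finite_group by (simp add: star_def direct_sum_def PiE_iff ball_Un ball_simps) blast

lemma star_values:
  assumes "x \<in> Obs" "s \<in> carrier (star smash_cat x)" "y \<in> Obs"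
  shows "val (s (Inl y)) \<in> V (deg x y)" "val (s (Inr y)) \<in> V (deg y x)"
    and "val (s (Inl y)) \<in> carrier A" "val (s (Inr y)) \<in> carrier A"
    and "mor (val (s (Inl y))) = s (Inl y)" "mor (val (s (Inr y))) = s (Inr y)"
proof -
  have "s (Inl y) \<in> mor ` V (deg x y)" "s (Inr y) \<in> mor ` V (deg y x)"
    using assms(2,3) unfolding mem_star_iff by blast+
  note val_hom[OF assms(1,3) this(1)] val_hom[OF assms(3,1) this(2)]
  then show "val (s (Inl y)) \<in> V (deg x y)" "val (s (Inr y)) \<in> V (deg y x)"
    "val (s (Inl y)) \<in> carrier A" "val (s (Inr y)) \<in> carrier A"
    "mor (val (s (Inl y))) = s (Inl y)" "mor (val (s (Inr y))) = s (Inr y)"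
    by auto
qed

text \<open>
  The star map sums over the support of \<open>s\<close>. Since \<open>G\<close> is finite, the sum may be taken over all
  objects, and in this form it is visibly linear and comparable with the decomposition of \<open>A\<close>.
\<close>

lemma star_map_components:
  assumes x: "x \<in> Obs" and s: "s \<in> carrier (star smash_cat x)"
  shows "star_proj x s (Inl ()) = (\<Oplus>\<^bsub>A\<^esub>y\<in>Obs. val (s (Inl y)))"
    and "star_proj x s (Inr ()) = (\<Oplus>\<^bsub>A\<^esub>y\<in>Obs. val (s (Inr y)))"
proof -
  note v = star_values[OF x s]
  have s_mem: "s (Inl y) \<in> mor ` V (deg x y)" "s (Inr y) \<in> mor ` V (deg y x)" if "y \<in> Obs" for y
    using s that unfolding mem_star_iff by blast+
  have fin: "finite Obs" using finite_group by simp
  have z: "val (mor \<zero>\<^bsub>A\<^esub>) = \<zero>\<^bsub>A\<^esub>" by simp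
  have "(\<Oplus>\<^bsub>A\<^esub>y\<in>{y \<in> Obs. s (Inl y) \<noteq> mor \<zero>\<^bsub>A\<^esub>}. FHom smash_proj x y (s (Inl y)))
      = (\<Oplus>\<^bsub>A\<^esub>y\<in>Obs. val (s (Inl y)))"
  proof (rule M.add.finprod_mono_neutral_cong_left[OF fin])
    show "\<And>i. i \<in> Obs - {y \<in> Obs. s (Inl y) \<noteq> mor \<zero>\<^bsub>A\<^esub>} \<Longrightarrow> val (s (Inl i)) = \<zero>\<^bsub>A\<^esub>"
      using z by (metis (mono_tags, lifting) DiffE mem_Collect_eq)
  qed (use x s_mem v in \<open>auto simp del: image_iff\<close>)
  moreover have "(\<Oplus>\<^bsub>A\<^esub>y\<in>{y \<in> Obs. s (Inr y) \<noteq> mor \<zero>\<^bsub>A\<^esub>}. FHom smash_proj y x (s (Inr y)))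
      = (\<Oplus>\<^bsub>A\<^esub>y\<in>Obs. val (s (Inr y)))"
  proof (rule M.add.finprod_mono_neutral_cong_left[OF fin])
    show "\<And>i. i \<in> Obs - {y \<in> Obs. s (Inr y) \<noteq> mor \<zero>\<^bsub>A\<^esub>} \<Longrightarrow> val (s (Inr i)) = \<zero>\<^bsub>A\<^esub>"
      using z by (metis (mono_tags, lifting) DiffE mem_Collect_eq)
  qed (use x s_mem v in \<open>auto simp del: image_iff\<close>)
  ultimately show "star_proj x s (Inl ()) = (\<Oplus>\<^bsub>A\<^esub>y\<in>Obs. val (s (Inl y)))"
    "star_proj x s (Inr ()) = (\<Oplus>\<^bsub>A\<^esub>y\<in>Obs. val (s (Inr y)))"
    by (simp_all add: star_map_def one_object_kcat_def)
qed

lemma star_map_extensional: "star_proj x s \<in> extensional base_index"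
  unfolding star_map_def by (simp add: one_object_kcat_def)

lemma base_index_eqI:
  assumes "s \<in> extensional base_index" "t \<in> extensional base_index"
    and "s (Inl ()) = t (Inl ())" "s (Inr ()) = t (Inr ())"
  shows "s = t"
  by (rule extensionalityI[OF assms(1,2)]) (use assms(3,4) in auto)

lemma carrier_star_one_object:
  "carrier (star (one_object_kcat A) b) = (\<Pi>\<^sub>E i\<in>base_index. carrier A)"
proof -
  have "(\<Pi>\<^sub>E i\<in>base_index. carrier (case i of Inl y \<Rightarrow> A | Inr y \<Rightarrow> A)) = (\<Pi>\<^sub>E i\<in>base_index. carrier A)"
    by (rule PiE_cong) auto
  then show ?thesis by (simp add: star_def direct_sum_def one_object_kcat_def)
qed

lemma star_map_closed:
  assumes x: "x \<in> Obs" and s: "s \<in> carrier (star smash_cat x)"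
  shows "star_proj x s \<in> carrier (star (one_object_kcat A) b)"
proof -
  have "(\<Oplus>\<^bsub>A\<^esub>y\<in>Obs. val (s (Inl y))) \<in> carrier A" "(\<Oplus>\<^bsub>A\<^esub>y\<in>Obs. val (s (Inr y))) \<in> carrier A"
    using star_values[OF x s] by (auto intro!: M.add.finprod_closed)
  then show ?thesis
    unfolding carrier_star_one_object PiE_iff ball_Un
    using star_map_extensional star_map_components[OF x s] by simp
qed

lemma star_map_add:
  assumes x: "x \<in> Obs" and s: "s \<in> carrier (star smash_cat x)" and t: "t \<in> carrier (star smash_cat x)"
  shows "star_proj x (s \<oplus>\<^bsub>star smash_cat x\<^esub> t) = star_proj x s \<oplus>\<^bsub>star (one_object_kcat A) b\<^esub> star_proj x t"
proof -
  define r where "r = s \<oplus>\<^bsub>star smash_cat x\<^esub> t"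
  note vs = star_values[OF x s] and vt = star_values[OF x t]
  have r_at: "r (Inl y) = mor (val (s (Inl y)) \<oplus>\<^bsub>A\<^esub> val (t (Inl y)))"
    "r (Inr y) = mor (val (s (Inr y)) \<oplus>\<^bsub>A\<^esub> val (t (Inr y)))" if "y \<in> Obs" for y
    using that by (simp_all add: r_def star_def direct_sum_def)
  have "r \<in> extensional star_index" by (simp add: r_def star_def direct_sum_def)
  then have r: "r \<in> carrier (star smash_cat x)"
    unfolding mem_star_iff
    using r_at vs vt piece_add[OF deg_closed[OF x]] piece_add[OF deg_closed[OF _ x]]
    by (metis image_eqI)
  have "star_proj x r (Inl ()) = star_proj x s (Inl ()) \<oplus>\<^bsub>A\<^esub> star_proj x t (Inl ())"
  proof -
    have "(\<Oplus>\<^bsub>A\<^esub>y\<in>Obs. val (r (Inl y))) = (\<Oplus>\<^bsub>A\<^esub>y\<in>Obs. val (s (Inl y)) \<oplus>\<^bsub>A\<^esub> val (t (Inl y)))"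
      by (rule M.add.finprod_cong') (use r_at vs vt in \<open>auto simp del: image_iff\<close>)
    also have "\<dots> = (\<Oplus>\<^bsub>A\<^esub>y\<in>Obs. val (s (Inl y))) \<oplus>\<^bsub>A\<^esub> (\<Oplus>\<^bsub>A\<^esub>y\<in>Obs. val (t (Inl y)))"
      by (rule M.add.finprod_multf; rule Pi_I; erule vs vt)
    finally show ?thesis using star_map_components(1)[OF x] r s t by simp
  qed
  moreover have "star_proj x r (Inr ()) = star_proj x s (Inr ()) \<oplus>\<^bsub>A\<^esub> star_proj x t (Inr ())"
  proof -
    have "(\<Oplus>\<^bsub>A\<^esub>y\<in>Obs. val (r (Inr y))) = (\<Oplus>\<^bsub>A\<^esub>y\<in>Obs. val (s (Inr y)) \<oplus>\<^bsub>A\<^esub> val (t (Inr y)))"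
      by (rule M.add.finprod_cong') (use r_at vs vt in \<open>auto simp del: image_iff\<close>)
    also have "\<dots> = (\<Oplus>\<^bsub>A\<^esub>y\<in>Obs. val (s (Inr y))) \<oplus>\<^bsub>A\<^esub> (\<Oplus>\<^bsub>A\<^esub>y\<in>Obs. val (t (Inr y)))"
      by (rule M.add.finprod_multf; rule Pi_I; erule vs vt)
    finally show ?thesis using star_map_components(2)[OF x] r s t by simp
  qed
  ultimately show ?thesis
    unfolding r_def[symmetric]
    by (intro base_index_eqI[OF star_map_extensional])
      (simp_all add: star_def direct_sum_def one_object_kcat_def)
qed

lemma star_map_smult:
  assumes x: "x \<in> Obs" and a: "a \<in> carrier k" and s: "s \<in> carrier (star smash_cat x)"
  shows "star_proj x (a \<odot>\<^bsub>star smash_cat x\<^esub> s) = a \<odot>\<^bsub>star (one_object_kcat A) b\<^esub> star_proj x s"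
proof -
  define r where "r = a \<odot>\<^bsub>star smash_cat x\<^esub> s"
  have fin: "finite Obs" using finite_group by simp
  note vs = star_values[OF x s]
  have r_at: "r (Inl y) = mor (a \<odot>\<^bsub>A\<^esub> val (s (Inl y)))" "r (Inr y) = mor (a \<odot>\<^bsub>A\<^esub> val (s (Inr y)))"
    if "y \<in> Obs" for y
    using that by (simp_all add: r_def star_def direct_sum_def)
  have "r \<in> extensional star_index" by (simp add: r_def star_def direct_sum_def)
  then have r: "r \<in> carrier (star smash_cat x)"
    unfolding mem_star_iff
    using r_at vs a piece_smult[OF deg_closed[OF x]] piece_smult[OF deg_closed[OF _ x]]
    by (metis image_eqI)
  have "star_proj x r (Inl ()) = a \<odot>\<^bsub>A\<^esub> star_proj x s (Inl ())"
  proof -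
    have "(\<Oplus>\<^bsub>A\<^esub>y\<in>Obs. val (r (Inl y))) = (\<Oplus>\<^bsub>A\<^esub>y\<in>Obs. a \<odot>\<^bsub>A\<^esub> val (s (Inl y)))"
      by (rule M.add.finprod_cong') (use r_at vs a in \<open>auto simp del: image_iff\<close>)
    also have "\<dots> = a \<odot>\<^bsub>A\<^esub> (\<Oplus>\<^bsub>A\<^esub>y\<in>Obs. val (s (Inl y)))"
      by (rule finsum_smult_ldistr[OF fin a, symmetric]; rule Pi_I; erule vs)
    finally show ?thesis using star_map_components(1)[OF x] r s by simp
  qed
  moreover have "star_proj x r (Inr ()) = a \<odot>\<^bsub>A\<^esub> star_proj x s (Inr ())"
  proof -
    have "(\<Oplus>\<^bsub>A\<^esub>y\<in>Obs. val (r (Inr y))) = (\<Oplus>\<^bsub>A\<^esub>y\<in>Obs. a \<odot>\<^bsub>A\<^esub> val (s (Inr y)))"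
      by (rule M.add.finprod_cong') (use r_at vs a in \<open>auto simp del: image_iff\<close>)
    also have "\<dots> = a \<odot>\<^bsub>A\<^esub> (\<Oplus>\<^bsub>A\<^esub>y\<in>Obs. val (s (Inr y)))"
      by (rule finsum_smult_ldistr[OF fin a, symmetric]; rule Pi_I; erule vs)
    finally show ?thesis using star_map_components(2)[OF x] r s by simp
  qed
  ultimately show ?thesis
    unfolding r_def[symmetric]
    by (intro base_index_eqI[OF star_map_extensional])
      (simp_all add: star_def direct_sum_def one_object_kcat_def)
qed

lemma star_map_inj:
  assumes x: "x \<in> Obs"
  shows "inj_on (star_proj x) (carrier (star smash_cat x))"
proof (rule inj_onI)
  fix s t
  assume s: "s \<in> carrier (star smash_cat x)" and t: "t \<in> carrier (star smash_cat x)"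
    and eq: "star_proj x s = star_proj x t"
  note v = star_values[OF x s] star_values[OF x t]
  have out: "val (s (Inl y)) = val (t (Inl y))" if "y \<in> Obs" for y
  proof (rule decomposition_unique[OF bij_deg_target[OF x]])
    show "(\<Oplus>\<^bsub>A\<^esub>y\<in>Obs. val (s (Inl y))) = (\<Oplus>\<^bsub>A\<^esub>y\<in>Obs. val (t (Inl y)))"
      using fun_cong[OF eq, of "Inl ()"]
      unfolding star_map_components(1)[OF x s] star_map_components(1)[OF x t] .
  qed (use v that in auto)
  have into: "val (s (Inr y)) = val (t (Inr y))" if "y \<in> Obs" for y
  proof (rule decomposition_unique[OF bij_deg_source[OF x]])
    show "(\<Oplus>\<^bsub>A\<^esub>y\<in>Obs. val (s (Inr y))) = (\<Oplus>\<^bsub>A\<^esub>y\<in>Obs. val (t (Inr y)))"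
      using fun_cong[OF eq, of "Inr ()"]
      unfolding star_map_components(2)[OF x s] star_map_components(2)[OF x t] .
  qed (use v that in auto)
  show "s = t"
  proof (rule extensionalityI)
    show "s \<in> extensional star_index" "t \<in> extensional star_index"
      using s t unfolding mem_star_iff by auto
    show "s i = t i" if "i \<in> star_index" for i
      using that out into v(5,6,11,12) by (metis UnE imageE)
  qed
qed

lemma star_map_surj:
  assumes x: "x \<in> Obs" and w: "w \<in> carrier (star (one_object_kcat A) b)"
  shows "w \<in> star_proj x ` carrier (star smash_cat x)"
proof -
  have "w (Inl ()) \<in> carrier A" "w (Inr ()) \<in> carrier A"
    using w unfolding carrier_star_one_object by auto
  then obtain t t' where t: "t \<in> (\<Pi> y\<in>Obs. V (deg x y))" "w (Inl ()) = finsum A t Obs"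
    and t': "t' \<in> (\<Pi> y\<in>Obs. V (deg y x))" "w (Inr ()) = finsum A t' Obs"
    using decomposition_reindex[OF bij_deg_target[OF x]] decomposition_reindex[OF bij_deg_source[OF x]]
    by meson
  define s where "s = (\<lambda>i\<in>star_index. case i of Inl y \<Rightarrow> mor (t y) | Inr y \<Rightarrow> mor (t' y))"
  have s_at: "s (Inl y) = mor (t y)" "s (Inr y) = mor (t' y)" if "y \<in> Obs" for y
    using that by (simp_all add: s_def)
  have tc: "t y \<in> carrier A" "t' y \<in> carrier A" if "y \<in> Obs" for y
    using piece_carrier[OF deg_closed[OF x that]] piece_carrier[OF deg_closed[OF that x]]
      Pi_mem[OF t(1) that] Pi_mem[OF t'(1) that] by blast+
  have "s \<in> extensional star_index" by (simp add: s_def)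
  then have s: "s \<in> carrier (star smash_cat x)"
    unfolding mem_star_iff using s_at Pi_mem[OF t(1)] Pi_mem[OF t'(1)] by simp
  have "star_proj x s = w"
  proof (rule base_index_eqI[OF star_map_extensional])
    show "w \<in> extensional base_index"
      using w unfolding carrier_star_one_object by (simp add: PiE_iff)
    have "(\<Oplus>\<^bsub>A\<^esub>y\<in>Obs. val (s (Inl y))) = finsum A t Obs"
      by (rule M.add.finprod_cong') (use s_at tc in \<open>auto simp del: image_iff\<close>)
    then show "star_proj x s (Inl ()) = w (Inl ())" using star_map_components(1)[OF x s] t by simp
    have "(\<Oplus>\<^bsub>A\<^esub>y\<in>Obs. val (s (Inr y))) = finsum A t' Obs"
      by (rule M.add.finprod_cong') (use s_at tc in \<open>auto simp del: image_iff\<close>)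
    then show "star_proj x s (Inr ()) = w (Inr ())" using star_map_components(2)[OF x s] t' by simp
  qed
  with s show ?thesis by blast
qed

text \<open>
  For a fixed object \<open>x\<close>, the degrees of the morphisms from \<open>x\<close> to the various objects run through
  \<open>G\<close> exactly once, and so do the degrees of the morphisms into \<open>x\<close>. Each half of the star is
  therefore the direct sum of all homogeneous components, which is \<open>A\<close>.
\<close>

lemma smash_proj_covering: "covering k smash_cat (one_object_kcat A) smash_proj"
  unfolding covering_def
proof (intro conjI ballI)
  show "k_functor k smash_cat (one_object_kcat A) smash_proj"
    by (rule smash_proj_k_functor)
  have "Obs \<noteq> {}" using G.one_closed by blast
  then show "FOb smash_proj ` Ob smash_cat = Ob (one_object_kcat A)"
    by (auto simp: one_object_kcat_def smash_proj_def)
next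
  fix b x assume "b \<in> Ob (one_object_kcat A)" "x \<in> fibre smash_cat smash_proj b"
  then have x: "x \<in> Obs" by (simp add: fibre_def)
  show "linear_map_on k (star smash_cat x) (star (one_object_kcat A) b) (star_proj x)"
    unfolding linear_map_on_def
    using star_map_closed[OF x] star_map_add[OF x] star_map_smult[OF x] by blast
  show "bij_betw (star_proj x) (carrier (star smash_cat x)) (carrier (star (one_object_kcat A) b))"
    unfolding bij_betw_def using star_map_inj[OF x] star_map_closed[OF x] star_map_surj[OF x] by blast
qed

lemma translate_simps [simp]:
  "x \<in> Obs \<Longrightarrow> FOb (translate g) x = ob (idx x \<otimes>\<^bsub>G\<^esub> g)"
  "\<lbrakk>x \<in> Obs; y \<in> Obs; f \<in> mor ` V (deg x y)\<rbrakk> \<Longrightarrow> FHom (translate g) x y f = f"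
  unfolding translate_def by simp_all

lemma translate_Obs: "\<lbrakk>x \<in> Obs; g \<in> carrier G\<rbrakk> \<Longrightarrow> ob (idx x \<otimes>\<^bsub>G\<^esub> g) \<in> Obs"
  by auto

lemma translate_k_functor:
  assumes g: "g \<in> carrier G"
  shows "k_functor k smash_cat smash_cat (translate g)"
proof -
  interpret C: k_category k smash_cat by (rule smash_cat_k_category)
  show ?thesis
  proof (intro k_functor.intro k_functor_axioms.intro)
    show "FOb (translate g) \<in> Ob smash_cat \<rightarrow>\<^sub>E Ob smash_cat"
      using g by (auto simp: translate_def)
  next
    fix x y z f h
    assume *: "x \<in> Ob smash_cat" "y \<in> Ob smash_cat" "z \<in> Ob smash_cat"
      "f \<in> carrier (Hom smash_cat x y)" "h \<in> carrier (Hom smash_cat y z)"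
    then have "mor (val h \<otimes>\<^bsub>A\<^esub> val f) \<in> mor ` V (deg x z)"
      using comp_piece[of x y z "val f" "val h"] val_hom by simp
    then show "FHom (translate g) x z (Comp smash_cat x y z h f) =
      Comp smash_cat (FOb (translate g) x) (FOb (translate g) y) (FOb (translate g) z)
        (FHom (translate g) y z h) (FHom (translate g) x y f)"
      using * by (simp del: image_iff)
  next
    fix x y assume xy: "x \<in> Ob smash_cat" "y \<in> Ob smash_cat"
    then show "linear_map_on k (Hom smash_cat x y) (Hom smash_cat (FOb (translate g) x) (FOb (translate g) y))
      (FHom (translate g) x y)"
      using g piece_add[OF deg_closed, of x y] piece_smult[OF deg_closed, of x y] val_hom[of x y]
      by (auto simp: linear_map_on_def deg_translate simp del: image_iff)
  next
    fix x assume "x \<in> Ob smash_cat"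
    then show "FHom (translate g) x x (Ident smash_cat x) = Ident smash_cat (FOb (translate g) x)"
      using one_piece deg_self by simp
  qed (auto simp: translate_def smash_cat_k_category)
qed

lemma translate_inverse:
  assumes g: "g \<in> carrier G" and h: "h \<in> carrier G" and gh: "g \<otimes>\<^bsub>G\<^esub> h = \<one>\<^bsub>G\<^esub>"
  shows "comp_kfun smash_cat (translate h) (translate g) = id_kfun smash_cat"
proof -
  have "idx x \<otimes>\<^bsub>G\<^esub> g \<otimes>\<^bsub>G\<^esub> h = idx x" if "x \<in> Obs" for x
    using idx_closed[OF that] g h gh by (simp add: G.m_assoc)
  moreover have "FHom (translate h) (ob (idx x \<otimes>\<^bsub>G\<^esub> g)) (ob (idx y \<otimes>\<^bsub>G\<^esub> g)) f = f"
    if "x \<in> Obs" "y \<in> Obs" "f \<in> mor ` V (deg x y)" for x y f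
    using that g translate_Obs by (simp add: deg_translate del: image_iff)
  ultimately show ?thesis
    using g translate_Obs[OF _ g]
    unfolding comp_kfun_def id_kfun_def
    by (auto simp: restrict_def fun_eq_iff simp del: image_iff intro!: arg_cong[where f = ob])
qed

lemma translate_Aut1:
  assumes g: "g \<in> carrier G"
  shows "translate g \<in> Aut1 k smash_cat smash_proj"
proof -
  have "k_isomorphism k smash_cat smash_cat (translate g)"
    unfolding k_isomorphism_def
    using g translate_k_functor translate_inverse[of g "inv\<^bsub>G\<^esub> g"] translate_inverse[of "inv\<^bsub>G\<^esub> g" g]
    by (intro conjI exI[of _ "translate (inv\<^bsub>G\<^esub> g)"]) auto
  moreover have "comp_kfun smash_cat smash_proj (translate g) = smash_proj"
  proof -
    have "FHom smash_proj (ob (idx x \<otimes>\<^bsub>G\<^esub> g)) (ob (idx y \<otimes>\<^bsub>G\<^esub> g)) f = val f"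
      if "x \<in> Obs" "y \<in> Obs" "f \<in> mor ` V (deg x y)" for x y f
      using that g translate_Obs by (simp add: deg_translate del: image_iff)
    then show ?thesis
      unfolding comp_kfun_def
      by (subst (3) smash_proj_def) (auto simp: restrict_def fun_eq_iff simp del: image_iff)
  qed
  ultimately show ?thesis unfolding Aut1_def by blast
qed

lemma smash_cat_connected: "connected_kcat smash_cat"
  unfolding connected_kcat_def
proof (intro ballI)
  fix x y assume xy: "x \<in> Ob smash_cat" "y \<in> Ob smash_cat"
  then have d: "deg x y \<in> carrier G" by (simp del: image_iff)
  then obtain u where u: "u \<in> V (deg x y)" "u \<noteq> \<zero>\<^bsub>A\<^esub>" using piece_nonzero by blast
  then have "mor u \<noteq> mor \<zero>\<^bsub>A\<^esub>" using piece_carrier[OF d u(1)] mor_inj by (metis M.zero_closed val_mor)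
  then have "nonzero_walk smash_cat x y [(x, y, mor u, True)]"
    using xy u unfolding nonzero_walk_def nonzero_steps_def by simp
  then show "\<exists>w. nonzero_walk smash_cat x y w" by blast
qed

text \<open>
  The objects form a single fibre, on which the right translations of \<open>G\<close> act transitively.
\<close>

lemma smash_proj_galois: "galois_covering k smash_cat (one_object_kcat A) smash_proj"
  unfolding galois_covering_def
proof (intro conjI bexI[of _ "()"] ballI)
  show "() \<in> Ob (one_object_kcat A)" by (simp add: one_object_kcat_def)
  fix x y assume "x \<in> fibre smash_cat smash_proj ()" "y \<in> fibre smash_cat smash_proj ()"
  then have xy: "x \<in> Obs" "y \<in> Obs" by (simp_all add: fibre_def)
  define g where "g = inv\<^bsub>G\<^esub> (idx x) \<otimes>\<^bsub>G\<^esub> idx y"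
  have c: "idx x \<in> carrier G" "idx y \<in> carrier G" using xy idx_closed by auto
  then have "idx x \<otimes>\<^bsub>G\<^esub> g = idx y" "g \<in> carrier G"
    by (simp_all add: g_def G.m_assoc[symmetric])
  then have "FOb (translate g) x = y" "translate g \<in> Aut1 k smash_cat smash_proj"
    using xy translate_Aut1 by auto
  then show "\<exists>T\<in>Aut1 k smash_cat smash_proj. FOb T x = y" by blast
qed (use smash_proj_covering smash_cat_connected in auto)

end

section \<open>Universal coverings and homogeneous elements\<close>

context smash_product begin

text \<open>
  A morphism of coverings commutes with the projections to \<open>A\<close>, and the projection of any morphism
  of the smash product is homogeneous.
\<close>

lemma covering_morphism_homogeneous:
  assumes P: "k_functor k U (one_object_kcat A) P"
    and H: "covering_morphism k (one_object_kcat A) U P smash_cat smash_proj (H, id_kfun (one_object_kcat A))"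
    and uv: "u \<in> Ob U" "v \<in> Ob U" and f: "f \<in> carrier (Hom U u v)"
  shows "\<exists>g\<in>carrier G. FHom P u v f \<in> V g"
proof -
  interpret P: k_functor k U "one_object_kcat A" P by (rule P)
  interpret H: k_functor k U smash_cat H using H by (simp add: covering_morphism_def)
  have eq: "comp_kfun U smash_proj H = comp_kfun U (id_kfun (one_object_kcat A)) P"
    using H by (simp add: covering_morphism_def)
  have x: "FOb H u \<in> Obs" "FOb H v \<in> Obs" using H.fob_closed uv by auto
  have Hf: "FHom H u v f \<in> mor ` V (deg (FOb H u) (FOb H v))"
    using H.fhom_linear[OF uv] f by (auto simp: linear_map_on_def)
  have Pf: "FHom P u v f \<in> carrier A"
    using P.fhom_linear[OF uv] f by (auto simp: linear_map_on_def one_object_kcat_def)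
  have "FHom P u v f = FHom (comp_kfun U (id_kfun (one_object_kcat A)) P) u v f"
    using uv f Pf by (simp add: comp_kfun_def id_kfun_def one_object_kcat_def)
  also have "\<dots> = val (FHom H u v f)"
    unfolding eq[symmetric] using uv f x Hf by (simp add: comp_kfun_def)
  finally show ?thesis using val_hom(1)[OF x Hf] deg_closed[OF x] by auto
qed

lemma universal_covering_homogeneous:
  assumes U: "universal_covering TYPE('o) TYPE('n) k U (one_object_kcat A) P"
    and uv: "u \<in> Ob U" "v \<in> Ob U" and f: "f \<in> carrier (Hom U u v)"
  shows "\<exists>g\<in>carrier G. FHom P u v f \<in> V g"
proof -
  have P: "k_functor k U (one_object_kcat A) P"
    using U unfolding universal_covering_def galois_covering_def covering_def by blast
  have c: "ob \<one>\<^bsub>G\<^esub> \<in> Ob smash_cat" by simp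
  obtain H where "covering_morphism k (one_object_kcat A) U P smash_cat smash_proj (H, id_kfun (one_object_kcat A))"
    using U smash_proj_galois uv(1) c unfolding universal_covering_def by fastforce
  from covering_morphism_homogeneous[OF P this uv f] show ?thesis .
qed

end

lemma (in submodule) finsum_mem:
  assumes "module R M" "finite Y" "\<And>y. y \<in> Y \<Longrightarrow> t y \<in> H"
  shows "finsum M t Y \<in> H"
proof -
  interpret m: module R M by fact
  show ?thesis using assms(2,3)
  proof (induction Y)
    case empty
    then show ?case using one_closed by simp
  next
    case (insert y Y)
    then have "finsum M t (insert y Y) = t y \<oplus>\<^bsub>M\<^esub> finsum M t Y"
      using subset by (intro m.M.add.finprod_insert) auto
    then show ?case using insert m_closed by simp
  qed
qed

text \<open>
  Surjectivity on stars writes an arbitrary element of \<open>A\<close> as a finite sum of images of morphisms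
  starting at one object of the covering.
\<close>

lemma covering_image_spans:
  assumes A: "algebra k A" and cov: "covering k U (one_object_kcat A) P"
    and W: "submodule W k A"
    and sub: "\<And>u v f. \<lbrakk>u \<in> Ob U; v \<in> Ob U; f \<in> carrier (Hom U u v)\<rbrakk> \<Longrightarrow> FHom P u v f \<in> W"
  shows "W = carrier A"
proof
  interpret A: algebra k A by (rule A)
  interpret W: submodule W k A by (rule W)
  let ?B = "one_object_kcat A"
  show "W \<subseteq> carrier A" using W.subset by simp
  show "carrier A \<subseteq> W"
  proof
    fix w assume w: "w \<in> carrier A"
    obtain u where u: "u \<in> Ob U" using cov by (auto simp: covering_def one_object_kcat_def)
    then have "u \<in> fibre U P ()" by (simp add: fibre_def)
    with cov have surj: "star_map U ?B P u ` carrier (star U u) = carrier (star ?B ())"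
      by (auto simp: covering_def one_object_kcat_def bij_betw_def)
    \<comment> \<open>Only the outgoing half of the star matters, so both components may be \<open>w\<close>.\<close>
    define s' where "s' = (\<lambda>i\<in>Inl ` {()} \<union> Inr ` {()}. w)"
    have "s' \<in> carrier (star ?B ())"
      using w by (auto simp: s'_def star_def direct_sum_def one_object_kcat_def)
    then have "s' \<in> star_map U ?B P u ` carrier (star U u)" unfolding surj .
    then obtain s where s: "s \<in> carrier (star U u)" "star_map U ?B P u s = s'" by (metis imageE)
    have s_mem: "s (Inl y) \<in> carrier (Hom U u y)" if "y \<in> Ob U" for y
    proof -
      have "s \<in> (\<Pi>\<^sub>E i\<in>Inl ` Ob U \<union> Inr ` Ob U. carrier (case i of Inl y \<Rightarrow> Hom U u y | Inr y \<Rightarrow> Hom U y u))"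
        using s(1) by (simp add: star_def direct_sum_def)
      from PiE_mem[OF this, of "Inl y"] that show ?thesis by simp
    qed
    let ?Y = "{y \<in> Ob U. s (Inl y) \<noteq> \<zero>\<^bsub>Hom U u y\<^esub>}"
    have "finite (Inl -` {i \<in> Inl ` Ob U \<union> Inr ` Ob U. s i \<noteq> \<zero>\<^bsub>case i of Inl y \<Rightarrow> Hom U u y | Inr y \<Rightarrow> Hom U y u\<^esub>})"
      using s(1) by (intro finite_vimageI) (auto simp: star_def direct_sum_def)
    then have fin: "finite ?Y" by (rule rev_finite_subset) auto
    have "w = star_map U ?B P u s (Inl ())" unfolding s(2) by (simp add: s'_def)
    also have "\<dots> = (\<Oplus>\<^bsub>A\<^esub>y\<in>?Y. FHom P u y (s (Inl y)))"
      by (simp add: star_map_def one_object_kcat_def)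
    also have "\<dots> \<in> W"
      using fin sub[OF u] s_mem by (intro W.finsum_mem[OF A.module]) auto
    finally show "w \<in> W" .
  qed
qed

section \<open>Gradings by the powers of an element\<close>

lemma (in abelian_monoid) finsum_lessThan_Suc_shift:
  assumes "f \<in> {..<Suc m} \<rightarrow> carrier G"
  shows "finsum G f {..<Suc m} = f 0 \<oplus> (\<Oplus>i\<in>{..<m}. f (Suc i))"
proof -
  have "finsum G f {..<Suc m} = f 0 \<oplus> finsum G f (Suc ` {..<m})"
    unfolding lessThan_Suc_eq_insert_0 using assms by (intro add.finprod_insert) auto
  moreover have "finsum G f (Suc ` {..<m}) = (\<Oplus>i\<in>{..<m}. f (Suc i))"
    using assms by (intro add.finprod_reindex) auto
  ultimately show ?thesis by simp
qed

context algebra begin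

definition power_span :: "'c \<Rightarrow> nat \<Rightarrow> 'c set" where
  "power_span z n = (\<lambda>a. \<Oplus>\<^bsub>M\<^esub>i\<in>{..<n}. a i \<odot>\<^bsub>M\<^esub> (z [^]\<^bsub>M\<^esub> i)) ` ({..<n} \<rightarrow> carrier R)"

lemma power_spanI:
  assumes "\<And>i. i < n \<Longrightarrow> a i \<in> carrier R" "u = (\<Oplus>\<^bsub>M\<^esub>i\<in>{..<n}. a i \<odot>\<^bsub>M\<^esub> (z [^]\<^bsub>M\<^esub> i))"
  shows "u \<in> power_span z n"
  using assms unfolding power_span_def by blast

lemma power_spanE:
  assumes "u \<in> power_span z n"
  obtains a where "\<And>i. i < n \<Longrightarrow> a i \<in> carrier R" "u = (\<Oplus>\<^bsub>M\<^esub>i\<in>{..<n}. a i \<odot>\<^bsub>M\<^esub> (z [^]\<^bsub>M\<^esub> i))"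
  using assms unfolding power_span_def by blast

lemma power_span_subset: "z \<in> carrier M \<Longrightarrow> power_span z n \<subseteq> carrier M"
  unfolding power_span_def by (auto intro!: M.add.finprod_closed)

lemma power_span_add:
  assumes z: "z \<in> carrier M" and u: "u \<in> power_span z n" and v: "v \<in> power_span z n"
  shows "u \<oplus>\<^bsub>M\<^esub> v \<in> power_span z n"
proof -
  obtain a where a: "\<And>i. i < n \<Longrightarrow> a i \<in> carrier R" "u = (\<Oplus>\<^bsub>M\<^esub>i\<in>{..<n}. a i \<odot>\<^bsub>M\<^esub> (z [^]\<^bsub>M\<^esub> i))"
    using u by (rule power_spanE) blast
  obtain b where b: "\<And>i. i < n \<Longrightarrow> b i \<in> carrier R" "v = (\<Oplus>\<^bsub>M\<^esub>i\<in>{..<n}. b i \<odot>\<^bsub>M\<^esub> (z [^]\<^bsub>M\<^esub> i))"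
    using v by (rule power_spanE) blast
  have "u \<oplus>\<^bsub>M\<^esub> v = (\<Oplus>\<^bsub>M\<^esub>i\<in>{..<n}. a i \<odot>\<^bsub>M\<^esub> (z [^]\<^bsub>M\<^esub> i) \<oplus>\<^bsub>M\<^esub> b i \<odot>\<^bsub>M\<^esub> (z [^]\<^bsub>M\<^esub> i))"
    unfolding a(2) b(2) using a(1) b(1) z by (intro M.add.finprod_multf[symmetric]) auto
  also have "\<dots> = (\<Oplus>\<^bsub>M\<^esub>i\<in>{..<n}. (a i \<oplus>\<^bsub>R\<^esub> b i) \<odot>\<^bsub>M\<^esub> (z [^]\<^bsub>M\<^esub> i))"
    using a(1) b(1) z by (intro M.add.finprod_cong') (auto simp: smult_l_distr)
  finally show ?thesis using a(1) b(1) by (intro power_spanI[of n "\<lambda>i. a i \<oplus>\<^bsub>R\<^esub> b i"]) auto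
qed

lemma power_span_smult:
  assumes z: "z \<in> carrier M" and d: "d \<in> carrier R" and u: "u \<in> power_span z n"
  shows "d \<odot>\<^bsub>M\<^esub> u \<in> power_span z n"
proof -
  obtain a where a: "\<And>i. i < n \<Longrightarrow> a i \<in> carrier R" "u = (\<Oplus>\<^bsub>M\<^esub>i\<in>{..<n}. a i \<odot>\<^bsub>M\<^esub> (z [^]\<^bsub>M\<^esub> i))"
    using u by (rule power_spanE) blast
  have "d \<odot>\<^bsub>M\<^esub> u = (\<Oplus>\<^bsub>M\<^esub>i\<in>{..<n}. d \<odot>\<^bsub>M\<^esub> (a i \<odot>\<^bsub>M\<^esub> (z [^]\<^bsub>M\<^esub> i)))"
    unfolding a(2) using a(1) z d by (intro finsum_smult_ldistr) auto
  also have "\<dots> = (\<Oplus>\<^bsub>M\<^esub>i\<in>{..<n}. (d \<otimes>\<^bsub>R\<^esub> a i) \<odot>\<^bsub>M\<^esub> (z [^]\<^bsub>M\<^esub> i))"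
    using a(1) z d by (intro M.add.finprod_cong') (auto simp: smult_assoc1)
  finally show ?thesis using a(1) d by (intro power_spanI[of n "\<lambda>i. d \<otimes>\<^bsub>R\<^esub> a i"]) auto
qed

lemma one_power_span:
  assumes z: "z \<in> carrier M"
  shows "\<one>\<^bsub>M\<^esub> \<in> power_span z (Suc m)"
proof (rule power_spanI)
  let ?a = "\<lambda>i::nat. if i = 0 then \<one>\<^bsub>R\<^esub> else \<zero>\<^bsub>R\<^esub>"
  have zi: "z [^]\<^bsub>M\<^esub> (i::nat) \<in> carrier M" for i using z by simp
  show "?a i \<in> carrier R" for i by simp
  have "(\<Oplus>\<^bsub>M\<^esub>i\<in>{..<Suc m}. ?a i \<odot>\<^bsub>M\<^esub> (z [^]\<^bsub>M\<^esub> i))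
      = ?a 0 \<odot>\<^bsub>M\<^esub> (z [^]\<^bsub>M\<^esub> (0::nat)) \<oplus>\<^bsub>M\<^esub> (\<Oplus>\<^bsub>M\<^esub>i\<in>{..<m}. ?a (Suc i) \<odot>\<^bsub>M\<^esub> (z [^]\<^bsub>M\<^esub> Suc i))"
    using zi by (intro M.finsum_lessThan_Suc_shift) auto
  also have "(\<Oplus>\<^bsub>M\<^esub>i\<in>{..<m}. ?a (Suc i) \<odot>\<^bsub>M\<^esub> (z [^]\<^bsub>M\<^esub> Suc i)) = (\<Oplus>\<^bsub>M\<^esub>i\<in>{..<m}. \<zero>\<^bsub>M\<^esub>)"
    using zi[of "Suc _"] by (intro M.add.finprod_cong') (auto simp del: nat_pow_Suc)
  finally show "\<one>\<^bsub>M\<^esub> = (\<Oplus>\<^bsub>M\<^esub>i\<in>{..<Suc m}. ?a i \<odot>\<^bsub>M\<^esub> (z [^]\<^bsub>M\<^esub> i))" by simp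
qed

text \<open>
  Multiplication by \<open>z\<close> shifts the coefficients, and the top one re-enters at degree \<open>0\<close>
  multiplied by \<open>c\<close>.
\<close>

lemma power_span_mult:
  assumes z: "z \<in> carrier M" and c: "c \<in> carrier R" and pow: "z [^]\<^bsub>M\<^esub> Suc m = c \<odot>\<^bsub>M\<^esub> \<one>\<^bsub>M\<^esub>"
    and u: "u \<in> power_span z (Suc m)"
  shows "u \<otimes>\<^bsub>M\<^esub> z \<in> power_span z (Suc m)"
proof -
  obtain a where a: "\<And>i. i < Suc m \<Longrightarrow> a i \<in> carrier R"
    and ua: "u = (\<Oplus>\<^bsub>M\<^esub>i\<in>{..<Suc m}. a i \<odot>\<^bsub>M\<^esub> (z [^]\<^bsub>M\<^esub> i))"
    using u by (rule power_spanE) blast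
  have zi: "z [^]\<^bsub>M\<^esub> (i::nat) \<in> carrier M" for i using z by simp
  define b where "b = (\<lambda>i. case i of 0 \<Rightarrow> a m \<otimes>\<^bsub>R\<^esub> c | Suc j \<Rightarrow> a j)"
  have b: "b i \<in> carrier R" if "i < Suc m" for i
    using a c that by (auto simp: b_def split: nat.splits)
  have t: "a i \<odot>\<^bsub>M\<^esub> (z [^]\<^bsub>M\<^esub> Suc i) \<in> carrier M" if "i < Suc m" for i
    by (rule smult_closed[OF a[OF that] zi])
  have "u \<otimes>\<^bsub>M\<^esub> z = (\<Oplus>\<^bsub>M\<^esub>i\<in>{..<Suc m}. (a i \<odot>\<^bsub>M\<^esub> (z [^]\<^bsub>M\<^esub> i)) \<otimes>\<^bsub>M\<^esub> z)"
    unfolding ua using a zi z by (intro finsum_ldistr) auto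
  also have "\<dots> = (\<Oplus>\<^bsub>M\<^esub>i\<in>{..<Suc m}. a i \<odot>\<^bsub>M\<^esub> (z [^]\<^bsub>M\<^esub> Suc i))"
    using a zi z by (intro M.add.finprod_cong') (auto simp: smult_assoc2)
  also have "\<dots> = a m \<odot>\<^bsub>M\<^esub> (z [^]\<^bsub>M\<^esub> Suc m) \<oplus>\<^bsub>M\<^esub> (\<Oplus>\<^bsub>M\<^esub>i\<in>{..<m}. a i \<odot>\<^bsub>M\<^esub> (z [^]\<^bsub>M\<^esub> Suc i))"
    unfolding lessThan_Suc using t by (intro M.add.finprod_insert) (auto simp del: nat_pow_Suc)
  also have "a m \<odot>\<^bsub>M\<^esub> (z [^]\<^bsub>M\<^esub> Suc m) = b 0 \<odot>\<^bsub>M\<^esub> (z [^]\<^bsub>M\<^esub> (0::nat))"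
    unfolding pow using a[of m] c by (simp add: b_def smult_assoc1)
  also have "(\<Oplus>\<^bsub>M\<^esub>i\<in>{..<m}. a i \<odot>\<^bsub>M\<^esub> (z [^]\<^bsub>M\<^esub> Suc i)) = (\<Oplus>\<^bsub>M\<^esub>i\<in>{..<m}. b (Suc i) \<odot>\<^bsub>M\<^esub> (z [^]\<^bsub>M\<^esub> Suc i))"
    by (simp add: b_def)
  also have "b 0 \<odot>\<^bsub>M\<^esub> (z [^]\<^bsub>M\<^esub> (0::nat)) \<oplus>\<^bsub>M\<^esub> \<dots> = (\<Oplus>\<^bsub>M\<^esub>i\<in>{..<Suc m}. b i \<odot>\<^bsub>M\<^esub> (z [^]\<^bsub>M\<^esub> i))"
    using b zi by (intro M.finsum_lessThan_Suc_shift[symmetric]) auto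
  finally show ?thesis using b by (intro power_spanI[of "Suc m" b])
qed

end

text \<open>
  If \<open>1, z, \<dots>, z\<^sup>n\<^sup>-\<^sup>1\<close> is a basis and \<open>z\<^sup>n\<close> is a scalar \<open>c\<close>, then the lines spanned by these
  powers grade \<open>A\<close> by the integers modulo \<open>n\<close>. In \<open>k[x]/(x\<^sup>p)\<close> this happens for \<open>z = x\<close> with
  \<open>c = 0\<close>, and in characteristic \<open>p\<close> also for \<open>z = 1 + x\<close> with \<open>c = 1\<close>.
\<close>

locale power_basis = algebra k A + K: field k
  for k :: "('a, 's) ring_scheme" and A :: "('a, 'm) module" +
  fixes z :: 'm and c :: 'a and n :: nat
  assumes z_closed: "z \<in> carrier A" and c_closed: "c \<in> carrier k" and n_pos: "0 < n"
    and z_pow: "z [^]\<^bsub>A\<^esub> n = c \<odot>\<^bsub>A\<^esub> \<one>\<^bsub>A\<^esub>"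
    and spanning: "u \<in> carrier A \<Longrightarrow>
      \<exists>a\<in>{..<n} \<rightarrow> carrier k. u = (\<Oplus>\<^bsub>A\<^esub>i\<in>{..<n}. a i \<odot>\<^bsub>A\<^esub> (z [^]\<^bsub>A\<^esub> i))"
    and power_independent: "\<lbrakk>a \<in> {..<n} \<rightarrow> carrier k;
      (\<Oplus>\<^bsub>A\<^esub>i\<in>{..<n}. a i \<odot>\<^bsub>A\<^esub> (z [^]\<^bsub>A\<^esub> i)) = \<zero>\<^bsub>A\<^esub>; i < n\<rbrakk> \<Longrightarrow> a i = \<zero>\<^bsub>k\<^esub>"
begin

definition power_line :: "int \<Rightarrow> 'm set" where
  "power_line d = (\<lambda>a. a \<odot>\<^bsub>A\<^esub> (z [^]\<^bsub>A\<^esub> nat d)) ` carrier k"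

lemma z_pow_closed: "z [^]\<^bsub>A\<^esub> (i::nat) \<in> carrier A"
  using z_closed by simp

lemma power_nonzero:
  assumes "i < n" shows "z [^]\<^bsub>A\<^esub> i \<noteq> \<zero>\<^bsub>A\<^esub>"
proof
  assume z: "z [^]\<^bsub>A\<^esub> i = \<zero>\<^bsub>A\<^esub>"
  define a where "a = (\<lambda>j. if j = i then \<one>\<^bsub>k\<^esub> else \<zero>\<^bsub>k\<^esub>)"
  have "(\<Oplus>\<^bsub>A\<^esub>j\<in>{..<n}. a j \<odot>\<^bsub>A\<^esub> (z [^]\<^bsub>A\<^esub> j)) = (\<Oplus>\<^bsub>A\<^esub>j\<in>{..<n}. \<zero>\<^bsub>A\<^esub>)"
    by (rule M.add.finprod_cong') (use z z_pow_closed in \<open>auto simp: a_def\<close>)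
  then have "a i = \<zero>\<^bsub>k\<^esub>"
    using assms by (intro power_independent) (auto simp: a_def)
  then show False using K.one_not_zero by (simp add: a_def)
qed

lemma z_pow_mod: "z [^]\<^bsub>A\<^esub> (i::nat) \<in> (\<lambda>a. a \<odot>\<^bsub>A\<^esub> (z [^]\<^bsub>A\<^esub> (i mod n))) ` carrier k"
proof (induction i rule: less_induct)
  case (less i)
  show ?case
  proof (cases "i < n")
    case True
    then show ?thesis using z_pow_closed[of i] by (intro image_eqI[of _ _ "\<one>\<^bsub>k\<^esub>"]) simp_all
  next
    case False
    then obtain a where a: "a \<in> carrier k" "z [^]\<^bsub>A\<^esub> (i - n) = a \<odot>\<^bsub>A\<^esub> (z [^]\<^bsub>A\<^esub> (i mod n))"
      using less[of "i - n"] n_pos by (auto simp: le_mod_geq)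
    have "z [^]\<^bsub>A\<^esub> i = z [^]\<^bsub>A\<^esub> n \<otimes>\<^bsub>A\<^esub> z [^]\<^bsub>A\<^esub> (i - n)"
      using False nat_pow_mult[OF z_closed, of n "i - n"] by simp
    also have "\<dots> = (c \<otimes>\<^bsub>k\<^esub> a) \<odot>\<^bsub>A\<^esub> (z [^]\<^bsub>A\<^esub> (i mod n))"
      unfolding z_pow using a c_closed z_pow_closed by (simp add: smult_assoc2 smult_assoc1)
    finally show ?thesis using a c_closed by blast
  qed
qed

lemma power_line_submodule: "submodule (power_line d) k A"
proof (rule submoduleI)
  fix u v a assume u: "u \<in> power_line d" and v: "v \<in> power_line d"
  then obtain b b' where b: "b \<in> carrier k" "u = b \<odot>\<^bsub>A\<^esub> (z [^]\<^bsub>A\<^esub> nat d)"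
    "b' \<in> carrier k" "v = b' \<odot>\<^bsub>A\<^esub> (z [^]\<^bsub>A\<^esub> nat d)" unfolding power_line_def by blast
  then show "u \<oplus>\<^bsub>A\<^esub> v \<in> power_line d"
    using smult_l_distr[of b b' "z [^]\<^bsub>A\<^esub> nat d"] z_pow_closed unfolding power_line_def
    by (metis R.a_closed image_eqI)
next
  fix u assume "u \<in> power_line d"
  then obtain b where b: "b \<in> carrier k" "u = b \<odot>\<^bsub>A\<^esub> (z [^]\<^bsub>A\<^esub> nat d)"
    unfolding power_line_def by blast
  then show "\<ominus>\<^bsub>A\<^esub> u \<in> power_line d"
    using smult_l_minus[of b "z [^]\<^bsub>A\<^esub> nat d"] z_pow_closed unfolding power_line_def
    by (metis R.a_inv_closed image_eqI)
next
  fix a u assume a: "a \<in> carrier k" and "u \<in> power_line d"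
  then obtain b where b: "b \<in> carrier k" "u = b \<odot>\<^bsub>A\<^esub> (z [^]\<^bsub>A\<^esub> nat d)"
    unfolding power_line_def by blast
  then show "a \<odot>\<^bsub>A\<^esub> u \<in> power_line d"
    using smult_assoc1[of a b "z [^]\<^bsub>A\<^esub> nat d"] a z_pow_closed unfolding power_line_def
    by (metis R.m_closed image_eqI)
next
  show "power_line d \<subseteq> carrier A" using z_pow_closed unfolding power_line_def by auto
  have "\<zero>\<^bsub>A\<^esub> = \<zero>\<^bsub>k\<^esub> \<odot>\<^bsub>A\<^esub> (z [^]\<^bsub>A\<^esub> nat d)" using z_pow_closed by simp
  then show "\<zero>\<^bsub>A\<^esub> \<in> power_line d" unfolding power_line_def by blast
qed

lemma finsum_residues:
  assumes "f \<in> {..<n} \<rightarrow> carrier A"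
  shows "(\<Oplus>\<^bsub>A\<^esub>d\<in>carrier (integer_mod_group n). f (nat d)) = finsum A f {..<n}"
proof -
  have "bij_betw nat {0..<int n} {..<n}"
    by (rule bij_betw_byWitness[of _ int]) auto
  then show ?thesis
    using M.add.finprod_reindex[of f nat "{0..<int n}"] assms n_pos
    by (simp add: carrier_integer_mod_group bij_betw_def)
qed

text \<open>
  Degrees are added modulo \<open>n\<close>; this is compatible with products because \<open>z\<^sup>i\<close> is a scalar
  multiple of \<open>z\<close> raised to the residue of \<open>i\<close>, by \<open>z_pow_mod\<close>.
\<close>

lemma power_graded: "graded_algebra k A (integer_mod_group n) power_line"
proof (intro graded_algebra.intro graded_algebra_axioms.intro)
  show "algebra k A" by (rule algebra_axioms)
  show "field k" by (rule K.field_axioms)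
  show "group (integer_mod_group n)" by simp
  show "finite (carrier (integer_mod_group n))"
    using n_pos by (simp add: carrier_integer_mod_group)
next
  fix d assume "d \<in> carrier (integer_mod_group n)"
  show "submodule (power_line d) k A" by (rule power_line_submodule)
next
  fix d assume "d \<in> carrier (integer_mod_group n)"
  then have "nat d < n" using n_pos by (auto simp: carrier_integer_mod_group)
  then have "z [^]\<^bsub>A\<^esub> nat d \<noteq> \<zero>\<^bsub>A\<^esub>" by (rule power_nonzero)
  moreover have "z [^]\<^bsub>A\<^esub> nat d = \<one>\<^bsub>k\<^esub> \<odot>\<^bsub>A\<^esub> (z [^]\<^bsub>A\<^esub> nat d)" using z_pow_closed by simp
  ultimately show "\<exists>u\<in>power_line d. u \<noteq> \<zero>\<^bsub>A\<^esub>"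
    unfolding power_line_def by (metis R.one_closed image_eqI)
next
  have "\<one>\<^bsub>A\<^esub> = \<one>\<^bsub>k\<^esub> \<odot>\<^bsub>A\<^esub> (z [^]\<^bsub>A\<^esub> nat 0)" by simp
  then show "\<one>\<^bsub>A\<^esub> \<in> power_line \<one>\<^bsub>integer_mod_group n\<^esub>"
    unfolding power_line_def one_integer_mod_group by (metis R.one_closed image_eqI)
next
  fix d e u v
  assume de: "d \<in> carrier (integer_mod_group n)" "e \<in> carrier (integer_mod_group n)"
    and u: "u \<in> power_line d" and v: "v \<in> power_line e"
  obtain a b where a: "a \<in> carrier k" "u = a \<odot>\<^bsub>A\<^esub> (z [^]\<^bsub>A\<^esub> nat d)"
    and b: "b \<in> carrier k" "v = b \<odot>\<^bsub>A\<^esub> (z [^]\<^bsub>A\<^esub> nat e)"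
    using u v unfolding power_line_def by blast
  obtain c' where c': "c' \<in> carrier k"
    "z [^]\<^bsub>A\<^esub> (nat d + nat e) = c' \<odot>\<^bsub>A\<^esub> (z [^]\<^bsub>A\<^esub> ((nat d + nat e) mod n))"
    using z_pow_mod[of "nat d + nat e"] by blast
  have nat: "(nat d + nat e) mod n = nat ((d + e) mod int n)"
    using de n_pos by (auto simp: carrier_integer_mod_group nat_mod_distrib nat_add_distrib)
  have "u \<otimes>\<^bsub>A\<^esub> v = a \<odot>\<^bsub>A\<^esub> (z [^]\<^bsub>A\<^esub> nat d \<otimes>\<^bsub>A\<^esub> v)"
    unfolding a(2) using a b z_pow_closed by (intro smult_assoc2) auto
  also have "z [^]\<^bsub>A\<^esub> nat d \<otimes>\<^bsub>A\<^esub> v = v \<otimes>\<^bsub>A\<^esub> z [^]\<^bsub>A\<^esub> nat d"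
    using b z_pow_closed by (intro m_comm) auto
  also have "\<dots> = b \<odot>\<^bsub>A\<^esub> (z [^]\<^bsub>A\<^esub> nat e \<otimes>\<^bsub>A\<^esub> z [^]\<^bsub>A\<^esub> nat d)"
    unfolding b(2) using b z_pow_closed by (intro smult_assoc2) auto
  also have "z [^]\<^bsub>A\<^esub> nat e \<otimes>\<^bsub>A\<^esub> z [^]\<^bsub>A\<^esub> nat d = z [^]\<^bsub>A\<^esub> (nat d + nat e)"
    using nat_pow_mult[OF z_closed] by (simp add: add.commute)
  finally have "u \<otimes>\<^bsub>A\<^esub> v = (a \<otimes>\<^bsub>k\<^esub> (b \<otimes>\<^bsub>k\<^esub> c')) \<odot>\<^bsub>A\<^esub> (z [^]\<^bsub>A\<^esub> nat ((d + e) mod int n))"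
    using c' a b z_pow_closed nat by (simp add: smult_assoc1)
  then show "u \<otimes>\<^bsub>A\<^esub> v \<in> power_line (d \<otimes>\<^bsub>integer_mod_group n\<^esub> e)"
    unfolding power_line_def mult_integer_mod_group using a b c' by auto
next
  fix u assume "u \<in> carrier A"
  then obtain a where a: "a \<in> {..<n} \<rightarrow> carrier k"
    "u = (\<Oplus>\<^bsub>A\<^esub>i\<in>{..<n}. a i \<odot>\<^bsub>A\<^esub> (z [^]\<^bsub>A\<^esub> i))" using spanning by blast
  define t where "t = (\<lambda>d. a (nat d) \<odot>\<^bsub>A\<^esub> (z [^]\<^bsub>A\<^esub> nat d))"
  have "t \<in> (\<Pi> d\<in>carrier (integer_mod_group n). power_line d)"
    using a(1) n_pos unfolding t_def power_line_def by (auto simp: carrier_integer_mod_group Pi_def)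
  moreover have "u = finsum A t (carrier (integer_mod_group n))"
    unfolding t_def a(2)
    by (rule finsum_residues[symmetric]) (use a(1) z_pow_closed in \<open>auto simp: Pi_def\<close>)
  ultimately show "\<exists>t\<in>\<Pi> d\<in>carrier (integer_mod_group n). power_line d.
      u = finsum A t (carrier (integer_mod_group n))" by blast
next
  fix t d
  assume t: "t \<in> (\<Pi> d\<in>carrier (integer_mod_group n). power_line d)"
    and zero: "finsum A t (carrier (integer_mod_group n)) = \<zero>\<^bsub>A\<^esub>"
    and d: "d \<in> carrier (integer_mod_group n)"
  have "\<forall>i\<in>{..<n}. \<exists>b. b \<in> carrier k \<and> t (int i) = b \<odot>\<^bsub>A\<^esub> (z [^]\<^bsub>A\<^esub> i)"
  proof
    fix i assume "i \<in> {..<n}"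
    then have "t (int i) \<in> power_line (int i)" using t n_pos by (auto simp: carrier_integer_mod_group Pi_def)
    then show "\<exists>b. b \<in> carrier k \<and> t (int i) = b \<odot>\<^bsub>A\<^esub> (z [^]\<^bsub>A\<^esub> i)" unfolding power_line_def by auto
  qed
  then obtain a where a: "\<And>i. i < n \<Longrightarrow> a i \<in> carrier k"
    "\<And>i. i < n \<Longrightarrow> t (int i) = a i \<odot>\<^bsub>A\<^esub> (z [^]\<^bsub>A\<^esub> i)"
    using bchoice[of "{..<n}"] by (metis lessThan_iff)
  have "finsum A t (carrier (integer_mod_group n))
      = (\<Oplus>\<^bsub>A\<^esub>d\<in>carrier (integer_mod_group n). a (nat d) \<odot>\<^bsub>A\<^esub> (z [^]\<^bsub>A\<^esub> nat d))"
  proof (rule M.add.finprod_cong')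
    fix d assume "d \<in> carrier (integer_mod_group n)"
    then have "nat d < n" "int (nat d) = d" using n_pos by (auto simp: carrier_integer_mod_group)
    then show "t d = a (nat d) \<odot>\<^bsub>A\<^esub> (z [^]\<^bsub>A\<^esub> nat d)" using a(2)[of "nat d"] by simp
  next
    show "(\<lambda>d. a (nat d) \<odot>\<^bsub>A\<^esub> (z [^]\<^bsub>A\<^esub> nat d)) \<in> carrier (integer_mod_group n) \<rightarrow> carrier A"
    proof
      fix d assume "d \<in> carrier (integer_mod_group n)"
      then have "nat d < n" using n_pos by (auto simp: carrier_integer_mod_group)
      then show "a (nat d) \<odot>\<^bsub>A\<^esub> (z [^]\<^bsub>A\<^esub> nat d) \<in> carrier A"
        by (intro smult_closed a(1) z_pow_closed)
    qed
  qed simp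
  also have "\<dots> = (\<Oplus>\<^bsub>A\<^esub>i\<in>{..<n}. a i \<odot>\<^bsub>A\<^esub> (z [^]\<^bsub>A\<^esub> i))"
    by (rule finsum_residues) (use a(1) z_pow_closed in \<open>auto simp: Pi_def\<close>)
  finally have sum: "(\<Oplus>\<^bsub>A\<^esub>i\<in>{..<n}. a i \<odot>\<^bsub>A\<^esub> (z [^]\<^bsub>A\<^esub> i)) = \<zero>\<^bsub>A\<^esub>" using zero by simp
  have nd: "nat d < n" "int (nat d) = d" using d n_pos by (auto simp: carrier_integer_mod_group)
  have "a (nat d) = \<zero>\<^bsub>k\<^esub>" using power_independent[OF _ sum nd(1)] a(1) by auto
  then show "t d = \<zero>\<^bsub>A\<^esub>" using a(2)[OF nd(1)] by (simp only: nd(2) smult_l_null[OF z_pow_closed])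
qed

lemma smult_pow:
  assumes "a \<in> carrier k" "u \<in> carrier A"
  shows "(a \<odot>\<^bsub>A\<^esub> u) [^]\<^bsub>A\<^esub> (m::nat) = (a [^]\<^bsub>k\<^esub> m) \<odot>\<^bsub>A\<^esub> (u [^]\<^bsub>A\<^esub> m)"
proof (induction m)
  case (Suc m)
  have c: "a [^]\<^bsub>k\<^esub> m \<in> carrier k" "u [^]\<^bsub>A\<^esub> m \<in> carrier A" using assms by simp_all
  have "(a \<odot>\<^bsub>A\<^esub> u) [^]\<^bsub>A\<^esub> Suc m = (a [^]\<^bsub>k\<^esub> m) \<odot>\<^bsub>A\<^esub> (u [^]\<^bsub>A\<^esub> m \<otimes>\<^bsub>A\<^esub> (a \<odot>\<^bsub>A\<^esub> u))"
    using Suc c assms by (simp add: smult_assoc2)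
  also have "u [^]\<^bsub>A\<^esub> m \<otimes>\<^bsub>A\<^esub> (a \<odot>\<^bsub>A\<^esub> u) = a \<odot>\<^bsub>A\<^esub> (u [^]\<^bsub>A\<^esub> m \<otimes>\<^bsub>A\<^esub> u)"
    using c assms by (simp add: smult_mult_right)
  finally show ?case using c assms by (simp add: smult_assoc1)
qed simp

lemma scalar_pow_eq_zero:
  assumes b: "b \<in> carrier k" and z: "(b [^]\<^bsub>k\<^esub> (m::nat)) \<odot>\<^bsub>A\<^esub> \<one>\<^bsub>A\<^esub> = \<zero>\<^bsub>A\<^esub>"
  shows "b = \<zero>\<^bsub>k\<^esub>"
proof (rule ccontr)
  assume "b \<noteq> \<zero>\<^bsub>k\<^esub>"
  then have "b \<in> Units k" using b K.field_Units by simp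
  then have "b [^]\<^bsub>k\<^esub> m \<in> Units k" by (rule R.Units_pow_closed)
  then obtain d where d: "d \<in> carrier k" "d \<otimes>\<^bsub>k\<^esub> (b [^]\<^bsub>k\<^esub> m) = \<one>\<^bsub>k\<^esub>"
    by (auto simp: Units_def)
  have "\<one>\<^bsub>A\<^esub> = (d \<otimes>\<^bsub>k\<^esub> (b [^]\<^bsub>k\<^esub> m)) \<odot>\<^bsub>A\<^esub> \<one>\<^bsub>A\<^esub>" using d by simp
  also have "\<dots> = d \<odot>\<^bsub>A\<^esub> ((b [^]\<^bsub>k\<^esub> m) \<odot>\<^bsub>A\<^esub> \<one>\<^bsub>A\<^esub>)" using d b by (intro smult_assoc1) auto
  also have "\<dots> = \<zero>\<^bsub>A\<^esub>" using d z by simp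
  finally show False using power_nonzero[OF n_pos] by simp
qed

end

lemma (in power_basis) smash_product_exists:
  assumes "infinite (UNIV :: 'o set)" "inj_on e (carrier A)"
  shows "\<exists>ob :: int \<Rightarrow> 'o. smash_product k A (integer_mod_group n) power_line ob e"
proof -
  obtain q :: "nat \<Rightarrow> 'o" where q: "inj q"
    using infinite_countable_subset[OF assms(1)] by blast
  have "inj_on (q \<circ> nat) (carrier (integer_mod_group n))"
    using n_pos by (auto simp: carrier_integer_mod_group intro!: inj_onI dest!: injD[OF q])
  then show ?thesis
    using power_graded assms(2) by (intro exI smash_product.intro smash_product_axioms.intro)
qed

lemma (in power_basis) universal_covering_in_power_line:
  fixes U :: "('a, 'u, 'n) kcat"
  assumes "infinite (UNIV :: 'o set)" and e: "inj_on (e :: 'm \<Rightarrow> 'e) (carrier A)"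
    and U: "universal_covering TYPE('o) TYPE('e) k U (one_object_kcat A) Q"
    and f: "u \<in> Ob U" "v \<in> Ob U" "f \<in> carrier (Hom U u v)"
  shows "\<exists>i<n. \<exists>a\<in>carrier k. FHom Q u v f = a \<odot>\<^bsub>A\<^esub> (z [^]\<^bsub>A\<^esub> i)"
proof -
  obtain ob :: "int \<Rightarrow> 'o" where ob: "smash_product k A (integer_mod_group n) power_line ob e"
    using smash_product_exists[OF assms(1) e] by blast
  obtain d where "d \<in> carrier (integer_mod_group n)" "FHom Q u v f \<in> power_line d"
    using smash_product.universal_covering_homogeneous[OF ob U f] by blast
  then have "nat d < n" "\<exists>a\<in>carrier k. FHom Q u v f = a \<odot>\<^bsub>A\<^esub> (z [^]\<^bsub>A\<^esub> nat d)"
    using n_pos by (auto simp: carrier_integer_mod_group power_line_def)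
  then show ?thesis by blast
qed

section \<open>The Frobenius map at one plus an element\<close>

lemma (in cring) binomial:
  assumes x: "x \<in> carrier R"
  shows "(\<one> \<oplus> x) [^] (m::nat) = (\<Oplus>i\<in>{..<Suc m}. [(m choose i)] \<cdot> (x [^] i))"
proof (induction m)
  case 0
  then show ?case using x by (simp add: lessThan_Suc)
next
  case (Suc m)
  define f where "f = (\<lambda>j i. [(m choose j)] \<cdot> (x [^] (i::nat)))"
  have f: "f j i \<in> carrier R" for i j using x by (simp add: f_def)
  have S: "(\<one> \<oplus> x) [^] m = (\<Oplus>i\<in>{..<Suc m}. f i i)" using Suc by (simp add: f_def)
  have "(\<Oplus>i\<in>{..<Suc m}. f i i) = (\<Oplus>i\<in>{..<Suc (Suc m)}. f i i)"
  proof (rule add.finprod_mono_neutral_cong_left)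
    show "\<And>i. i \<in> {..<Suc (Suc m)} - {..<Suc m} \<Longrightarrow> f i i = \<zero>" by (auto simp: f_def binomial_eq_0)
  qed (use f in auto)
  also have "\<dots> = f 0 0 \<oplus> (\<Oplus>i\<in>{..<Suc m}. f (Suc i) (Suc i))"
    by (rule finsum_lessThan_Suc_shift) (use f in auto)
  finally have shift: "(\<Oplus>i\<in>{..<Suc m}. f i i) = \<one> \<oplus> (\<Oplus>i\<in>{..<Suc m}. f (Suc i) (Suc i))"
    by (simp add: f_def)
  have mult: "(\<Oplus>i\<in>{..<Suc m}. f i i) \<otimes> x = (\<Oplus>i\<in>{..<Suc m}. f i (Suc i))"
  proof -
    have "(\<Oplus>i\<in>{..<Suc m}. f i i) \<otimes> x = (\<Oplus>i\<in>{..<Suc m}. f i i \<otimes> x)"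
      by (rule finsum_ldistr) (use f x in auto)
    also have "\<dots> = (\<Oplus>i\<in>{..<Suc m}. f i (Suc i))"
      by (rule add.finprod_cong') (use x f in \<open>auto simp: f_def add_pow_ldistr\<close>)
    finally show ?thesis .
  qed
  have "(\<one> \<oplus> x) [^] Suc m = (\<Oplus>i\<in>{..<Suc m}. f i i) \<oplus> (\<Oplus>i\<in>{..<Suc m}. f i i) \<otimes> x"
    using x f by (simp add: S r_distr)
  also have "\<dots> = \<one> \<oplus> ((\<Oplus>i\<in>{..<Suc m}. f i (Suc i)) \<oplus> (\<Oplus>i\<in>{..<Suc m}. f (Suc i) (Suc i)))"
    unfolding mult using f by (subst shift) (simp add: a_ac add.finprod_closed Pi_def)
  also have "(\<Oplus>i\<in>{..<Suc m}. f i (Suc i)) \<oplus> (\<Oplus>i\<in>{..<Suc m}. f (Suc i) (Suc i))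
      = (\<Oplus>i\<in>{..<Suc m}. f i (Suc i) \<oplus> f (Suc i) (Suc i))"
    by (rule add.finprod_multf[symmetric]) (use f in auto)
  also have "\<dots> = (\<Oplus>i\<in>{..<Suc m}. [(Suc m choose Suc i)] \<cdot> (x [^] Suc i))"
    by (rule add.finprod_cong') (use x in \<open>auto simp: f_def add.nat_pow_mult\<close>)
  also have "\<one> \<oplus> \<dots> = (\<Oplus>i\<in>{..<Suc (Suc m)}. [(Suc m choose i)] \<cdot> (x [^] i))"
    using finsum_lessThan_Suc_shift[of "\<lambda>i. [(Suc m choose i)] \<cdot> (x [^] i)" "Suc m"] x by (simp add: Pi_def)
  finally show ?case .
qed

text \<open>
  The binomial coefficients strictly between the ends are divisible by \<open>p\<close> and hence vanish.
\<close>

lemma (in cring) frobenius_one_add: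
  fixes p :: nat
  assumes x: "x \<in> carrier R" and p: "Factorial_Ring.prime p" and char: "[p] \<cdot> \<one> = \<zero>"
  shows "(\<one> \<oplus> x) [^] p = \<one> \<oplus> x [^] p"
proof -
  have kill: "[j] \<cdot> u = \<zero>" if dvd: "p dvd j" and u: "u \<in> carrier R" for j u
  proof -
    obtain q where q: "j = p * q" using dvd by (auto elim: dvdE)
    have "[p] \<cdot> w = \<zero>" if "w \<in> carrier R" for w
      using add_pow_ldistr[of \<one> w p] that char by simp
    then show ?thesis unfolding q using u by (metis add.nat_pow_closed add.nat_pow_pow mult.commute)
  qed
  obtain m where m: "p = Suc m" using prime_gt_0_nat[OF p] by (cases p) auto
  let ?f = "\<lambda>i. [(p choose i)] \<cdot> (x [^] i)"
  have "(\<one> \<oplus> x) [^] p = finsum R ?f {..<Suc p}" by (rule binomial[OF x])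
  also have "\<dots> = finsum R ?f {0, p}"
  proof (rule add.finprod_mono_neutral_cong_right)
    show "?f i = \<zero>" if "i \<in> {..<Suc p} - {0, p}" for i
      using that x by (intro kill dvd_choose_prime[OF _ _ _ p]) auto
  qed (use x in auto)
  also have "\<dots> = \<one> \<oplus> x [^] p" using x m by simp
  finally show ?thesis .
qed

section \<open>Truncated polynomial algebras\<close>

locale truncated_polynomials = field k for k :: "('a, 's) ring_scheme" +
  fixes n :: nat
  assumes n_pos: "0 < n"
begin

abbreviation "P \<equiv> univ_poly k (carrier k)"
abbreviation "I \<equiv> PIdl\<^bsub>P\<^esub> (X\<^bsub>k\<^esub> [^]\<^bsub>P\<^esub> n)"
abbreviation "A \<equiv> truncated_poly k n"
abbreviation "poly_class \<equiv> a_r_coset P I"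

sublocale P: domain P
  by (rule univ_poly_is_domain[OF carrier_is_subring])

lemma X_closed: "X\<^bsub>k\<^esub> \<in> carrier P"
  using var_closed(1)[OF carrier_is_subring] .

lemma X_pow_closed: "X\<^bsub>k\<^esub> [^]\<^bsub>P\<^esub> (i :: nat) \<in> carrier P"
  using X_closed by simp

sublocale I: ideal I P
  by (rule P.cgenideal_ideal[OF X_pow_closed])

sublocale Q: cring "P Quot I"
  by (rule I.quotient_is_cring) unfold_locales

lemma truncated_poly_simps [simp]:
  "carrier A = carrier (P Quot I)" "monoid.mult A = monoid.mult (P Quot I)"
  "\<one>\<^bsub>A\<^esub> = \<one>\<^bsub>P Quot I\<^esub>" "\<zero>\<^bsub>A\<^esub> = \<zero>\<^bsub>P Quot I\<^esub>" "ring.add A = ring.add (P Quot I)"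
  "a \<odot>\<^bsub>A\<^esub> u = poly_class (poly_of_const a) \<otimes>\<^bsub>P Quot I\<^esub> u"
  by (simp_all add: truncated_poly_def Let_def)

lemma cring_truncated: "cring A"
proof (rule cringI)
  show "abelian_group A"
    by (rule abelian_groupI) (auto simp: Q.a_ac intro: Q.l_neg Q.a_inv_closed)
  show "comm_monoid A"
    by (rule comm_monoidI) (auto simp: Q.m_ac)
qed (simp add: Q.l_distr)

lemma class_hom: "poly_class \<in> ring_hom P A"
  using ring_hom_memE[OF I.rcos_ring_hom] by (intro ring_hom_memI) simp_all

lemma poly_of_const_hom: "poly_of_const \<in> ring_hom k P"
  using canonical_embedding_is_hom[OF carrier_is_subring] by simp

lemma const_closed: "a \<in> carrier k \<Longrightarrow> poly_of_const a \<in> carrier P"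
  using ring_hom_memE(1)[OF poly_of_const_hom] .

lemma scalar_hom: "(\<lambda>a. poly_class (poly_of_const a)) \<in> ring_hom k A"
  using ring_hom_trans[OF poly_of_const_hom class_hom] by (simp add: comp_def)

lemma algebra_truncated: "algebra k A"
proof (rule algebraI)
  show "cring k" ..
  show "cring A" by (rule cring_truncated)
qed (use ring_hom_memE[OF scalar_hom] in \<open>auto simp: Q.l_distr Q.r_distr Q.m_assoc\<close>)

sublocale A: algebra k A by (rule algebra_truncated)

lemma class_surj: "u \<in> carrier A \<Longrightarrow> \<exists>f\<in>carrier P. u = poly_class f"
  by (auto simp: FactRing_def A_RCOSETS_def')

lemma class_eq_zero: "f \<in> carrier P \<Longrightarrow> poly_class f = \<zero>\<^bsub>A\<^esub> \<Longrightarrow> f \<in> I"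
  using I.rcos_const_imp_mem by (simp add: FactRing_def)

lemma class_of_ideal: "f \<in> I \<Longrightarrow> poly_class f = \<zero>\<^bsub>A\<^esub>"
  using I.a_rcos_const by (simp add: FactRing_def)

lemma class_closed: "f \<in> carrier P \<Longrightarrow> poly_class f \<in> carrier A"
  using ring_hom_memE(1)[OF class_hom] .

lemma class_const_mult:
  assumes "a \<in> carrier k" "f \<in> carrier P"
  shows "poly_class (poly_of_const a \<otimes>\<^bsub>P\<^esub> f) = a \<odot>\<^bsub>A\<^esub> poly_class f"
  using ring_hom_memE(2)[OF class_hom const_closed[OF assms(1)] assms(2)] by simp

lemma class_ring_hom: "ring_hom_ring P A poly_class"
  by (rule ring_hom_ringI2[OF P.ring_axioms cring.axioms(1)[OF cring_truncated] class_hom])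

text \<open>
  Written \<open>x\<close> in the comments, as in \<open>k[x]/(x\<^sup>n)\<close>.
\<close>

definition \<xi> :: "'a list set" where "\<xi> = poly_class X\<^bsub>k\<^esub>"

lemma xi_closed: "\<xi> \<in> carrier A"
  unfolding \<xi>_def by (rule class_closed[OF X_closed])

lemma xi_pow: "\<xi> [^]\<^bsub>A\<^esub> (i::nat) = poly_class (X\<^bsub>k\<^esub> [^]\<^bsub>P\<^esub> i)"
proof -
  interpret h: ring_hom_ring P A poly_class by (rule class_ring_hom)
  show ?thesis unfolding \<xi>_def using h.hom_nat_pow[OF X_closed] by simp
qed

lemma xi_pow_n: "\<xi> [^]\<^bsub>A\<^esub> n = \<zero>\<^bsub>A\<^esub>"
  unfolding xi_pow by (rule class_of_ideal[OF P.cgenideal_self[OF X_pow_closed]])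

text \<open>
  Polynomials are lists of coefficients, so a linear polynomial has length \<open>2\<close> and \<open>L\<^sup>i\<close> has
  length \<open>i + 1\<close>. A summand with nonzero coefficient is longer than the sum of all earlier ones,
  so it cannot be cancelled.
\<close>

lemma length_power_sum:
  assumes L: "L \<in> carrier P" "length L = 2" and a: "a \<in> {..<m} \<rightarrow> carrier k"
  defines "S \<equiv> \<lambda>m. \<Oplus>\<^bsub>P\<^esub>i\<in>{..<m}. poly_of_const (a i) \<otimes>\<^bsub>P\<^esub> L [^]\<^bsub>P\<^esub> i"
  shows "length (S m) \<le> m \<and> (S m = [] \<longrightarrow> (\<forall>i<m. a i = \<zero>\<^bsub>k\<^esub>))"
  using a
proof (induction m)
  case 0
  then show ?case by (simp add: S_def univ_poly_zero)
next
  case (Suc m)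
  define T where "T = poly_of_const (a m) \<otimes>\<^bsub>P\<^esub> L [^]\<^bsub>P\<^esub> m"
  have IH: "length (S m) \<le> m" "S m = [] \<Longrightarrow> \<forall>i<m. a i = \<zero>\<^bsub>k\<^esub>"
    using Suc.IH Suc.prems by (simp_all add: Pi_def)
  have am: "a m \<in> carrier k" using Suc.prems by auto
  have c: "poly_of_const (a i) \<otimes>\<^bsub>P\<^esub> L [^]\<^bsub>P\<^esub> i \<in> carrier P" if "i < Suc m" for i
    using Suc.prems that L const_closed by (auto simp: Pi_def)
  have T: "T \<in> carrier P" and Sm: "S m \<in> carrier P"
    using c unfolding T_def S_def by (auto intro!: P.add.finprod_closed)
  have S: "S (Suc m) = T \<oplus>\<^bsub>P\<^esub> S m"
    unfolding S_def T_def lessThan_Suc using c by (intro P.add.finprod_insert) auto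
  show ?case
  proof (cases "a m = \<zero>\<^bsub>k\<^esub>")
    case True
    then have "poly_of_const (a m) = \<zero>\<^bsub>P\<^esub>" by (simp add: poly_of_const_def univ_poly_zero)
    then have "T = \<zero>\<^bsub>P\<^esub>" unfolding T_def using L by simp
    then have "S (Suc m) = S m" using S Sm by simp
    with IH True show ?thesis by (auto simp: less_Suc_eq)
  next
    case False
    have ne: "L [^]\<^bsub>P\<^esub> m \<noteq> []" using polynomial_pow_not_zero[of L m] L by auto
    have "degree (L [^]\<^bsub>P\<^esub> m) = m" using polynomial_pow_degree[OF L(1), of m] L(2) by simp
    moreover have "polynomial\<^bsub>k\<^esub> (carrier k) [a m]" "polynomial\<^bsub>k\<^esub> (carrier k) (L [^]\<^bsub>P\<^esub> m)"
      using False am const_is_polynomial[of "a m" "carrier k"] P.nat_pow_closed[OF L(1)]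
      by (auto simp: univ_poly_carrier)
    ultimately have "degree T = m"
      using poly_mult_degree_eq[OF carrier_is_subring, of "[a m]" "L [^]\<^bsub>P\<^esub> m"] False ne
      by (simp add: T_def poly_of_const_def univ_poly_mult)
    moreover have "T \<noteq> []"
      unfolding T_def using P.integral_iff[of "[a m]" "L [^]\<^bsub>P\<^esub> m"] const_closed[OF am] False ne L
      by (simp add: univ_poly_zero poly_of_const_def)
    ultimately have len: "length T = Suc m" by (cases T) auto
    have "length (S (Suc m)) = max (length T) (length (S m))"
      unfolding S univ_poly_add
      by (rule poly_add_length_eq[OF carrier_is_subring])
        (use T Sm len IH(1) in \<open>auto simp: univ_poly_carrier\<close>)
    with len IH(1) have "length (S (Suc m)) = Suc m" by simp
    then show ?thesis by auto
  qed
qed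

text \<open>
  A relation among \<open>1, L, \<dots>, L\<^sup>n\<^sup>-\<^sup>1\<close> modulo \<open>x\<^sup>n\<close> is a multiple of \<open>x\<^sup>n\<close> of degree below \<open>n\<close>,
  hence zero already as a polynomial. The argument applies to \<open>x\<close> and to \<open>1 + x\<close> alike.
\<close>

lemma power_independent:
  assumes L: "L \<in> carrier P" "length L = 2" and a: "a \<in> {..<n} \<rightarrow> carrier k"
    and zero: "(\<Oplus>\<^bsub>A\<^esub>i\<in>{..<n}. a i \<odot>\<^bsub>A\<^esub> (poly_class L [^]\<^bsub>A\<^esub> i)) = \<zero>\<^bsub>A\<^esub>" and i: "i < n"
  shows "a i = \<zero>\<^bsub>k\<^esub>"
proof -
  interpret h: ring_hom_ring P A poly_class by (rule class_ring_hom)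
  define S where "S = (\<Oplus>\<^bsub>P\<^esub>i\<in>{..<n}. poly_of_const (a i) \<otimes>\<^bsub>P\<^esub> L [^]\<^bsub>P\<^esub> i)"
  have c: "poly_of_const (a i) \<otimes>\<^bsub>P\<^esub> L [^]\<^bsub>P\<^esub> i \<in> carrier P" if "i < n" for i
    using a that L const_closed by (auto simp: Pi_def)
  have S: "S \<in> carrier P" unfolding S_def using c by (auto intro!: P.add.finprod_closed)
  have "poly_class S = (\<Oplus>\<^bsub>A\<^esub>i\<in>{..<n}. poly_class (poly_of_const (a i) \<otimes>\<^bsub>P\<^esub> L [^]\<^bsub>P\<^esub> i))"
    unfolding S_def using c by (subst h.hom_finsum) (auto simp: comp_def)
  also have "\<dots> = (\<Oplus>\<^bsub>A\<^esub>i\<in>{..<n}. a i \<odot>\<^bsub>A\<^esub> (poly_class L [^]\<^bsub>A\<^esub> i))"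
  proof (rule A.M.add.finprod_cong')
    show "poly_class (poly_of_const (a i) \<otimes>\<^bsub>P\<^esub> L [^]\<^bsub>P\<^esub> i) = a i \<odot>\<^bsub>A\<^esub> (poly_class L [^]\<^bsub>A\<^esub> i)"
      if "i \<in> {..<n}" for i
      using class_const_mult[of "a i" "L [^]\<^bsub>P\<^esub> i"] a that L h.hom_nat_pow[OF L(1)] by auto
    show "(\<lambda>i. a i \<odot>\<^bsub>A\<^esub> (poly_class L [^]\<^bsub>A\<^esub> i)) \<in> {..<n} \<rightarrow> carrier A"
      using a L(1) A.smult_closed h.hom_closed A.nat_pow_closed by blast
  qed simp
  finally have "S \<in> I" using zero class_eq_zero[OF S] by simp
  then obtain g where g: "g \<in> carrier P" "S = g \<otimes>\<^bsub>P\<^esub> (X\<^bsub>k\<^esub> [^]\<^bsub>P\<^esub> n)"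
    unfolding cgenideal_def by blast
  have len: "length S \<le> n" "S = [] \<Longrightarrow> a i = \<zero>\<^bsub>k\<^esub>"
    using length_power_sum[OF L a] i unfolding S_def by auto
  have "S = []"
  proof (rule ccontr)
    assume ne: "S \<noteq> []"
    then have "g \<noteq> []" using g X_pow_closed[of n] by (auto simp: univ_poly_zero[of k "carrier k", symmetric])
    moreover have "X\<^bsub>k\<^esub> [^]\<^bsub>P\<^esub> n \<noteq> []"
      using polynomial_pow_not_zero[of "X\<^bsub>k\<^esub>" n] X_closed by (simp add: var_def)
    moreover have "degree (X\<^bsub>k\<^esub> [^]\<^bsub>P\<^esub> n) = n"
      using polynomial_pow_degree[OF X_closed, of n] by (simp add: var_def)
    ultimately have "degree S = degree g + n"
      using poly_mult_degree_eq[OF carrier_is_subring, of g "X\<^bsub>k\<^esub> [^]\<^bsub>P\<^esub> n"] g X_pow_closed[of n]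
      by (simp add: univ_poly_carrier univ_poly_mult)
    with len(1) n_pos show False by (simp add: ne)
  qed
  then show ?thesis by (rule len(2))
qed

text \<open>
  This reduces spanning statements for powers of some other generator to a closure property: if
  the span is stable under \<open>x\<close> and contains \<open>1\<close>, it is everything.
\<close>

lemma xi_generates:
  assumes W: "W \<subseteq> carrier A" and add: "\<And>u v. \<lbrakk>u \<in> W; v \<in> W\<rbrakk> \<Longrightarrow> u \<oplus>\<^bsub>A\<^esub> v \<in> W"
    and smult: "\<And>a u. \<lbrakk>a \<in> carrier k; u \<in> W\<rbrakk> \<Longrightarrow> a \<odot>\<^bsub>A\<^esub> u \<in> W"
    and one: "\<one>\<^bsub>A\<^esub> \<in> W" and xi: "\<And>u. u \<in> W \<Longrightarrow> u \<otimes>\<^bsub>A\<^esub> \<xi> \<in> W"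
  shows "W = carrier A"
proof
  interpret h: ring_hom_ring P A poly_class by (rule class_ring_hom)
  have pow: "\<xi> [^]\<^bsub>A\<^esub> (i::nat) \<in> W" for i
    by (induction i) (use one xi in \<open>simp_all del: truncated_poly_simps\<close>)
  have "poly_class (P.eval (map poly_of_const l) X\<^bsub>k\<^esub>) \<in> W" if "set l \<subseteq> carrier k" for l
    using that
  proof (induction l)
    case Nil
    have "\<zero>\<^bsub>k\<^esub> \<odot>\<^bsub>A\<^esub> \<one>\<^bsub>A\<^esub> \<in> W" using smult[OF _ one] by blast
    then show ?case using h.hom_zero A.smult_l_null A.one_closed by (simp del: truncated_poly_simps)
  next
    case (Cons a l)
    have a: "a \<in> carrier k" and l: "set (map poly_of_const l) \<subseteq> carrier P"
      using Cons.prems const_closed by auto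
    have e: "P.eval (map poly_of_const l) X\<^bsub>k\<^esub> \<in> carrier P"
      by (rule P.eval_in_carrier[OF l X_closed])
    have "poly_class (poly_of_const a \<otimes>\<^bsub>P\<^esub> X\<^bsub>k\<^esub> [^]\<^bsub>P\<^esub> length l) \<in> W"
      unfolding class_const_mult[OF a X_pow_closed] xi_pow[symmetric] by (rule smult[OF a pow])
    then show ?case
      using add[OF _ Cons.IH] Cons.prems const_closed[OF a] e X_pow_closed
      by (simp del: truncated_poly_simps)
  qed
  then show "carrier A \<subseteq> W"
    using class_surj eval_rewrite[OF carrier_is_subring]
    by (metis polynomial_incl subsetI univ_poly_carrier)
qed (rule W)

text \<open>
  Since \<open>z\<^sup>n\<close> is a scalar, the span of \<open>1, z, \<dots>, z\<^sup>n\<^sup>-\<^sup>1\<close> is stable under \<open>z = b + x\<close>. It is then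
  stable under \<open>x = z - b\<close> too, so it is the whole algebra.
\<close>

lemma power_basis_linear:
  assumes L: "L \<in> carrier P" "length L = 2" and b: "b \<in> carrier k" and c: "c \<in> carrier k"
    and Lx: "poly_class L = b \<odot>\<^bsub>A\<^esub> \<one>\<^bsub>A\<^esub> \<oplus>\<^bsub>A\<^esub> \<xi>"
    and pow: "poly_class L [^]\<^bsub>A\<^esub> n = c \<odot>\<^bsub>A\<^esub> \<one>\<^bsub>A\<^esub>"
  shows "power_basis k A (poly_class L) c n"
proof (intro power_basis.intro power_basis_axioms.intro)
  note [simp del] = truncated_poly_simps
  show "algebra k A" by (rule algebra_truncated)
  show "field k" by (rule field_axioms)
  define z where "z = poly_class L"
  show zc: "poly_class L \<in> carrier A" using class_closed L by blast
  then have z: "z \<in> carrier A" by (simp add: z_def)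
  obtain m where m: "n = Suc m" using n_pos by (cases n) auto
  note sub = A.power_span_subset[OF z, of n]
  have Wxi: "u \<otimes>\<^bsub>A\<^esub> \<xi> \<in> A.power_span z n" if "u \<in> A.power_span z n" for u
  proof -
    have u: "u \<in> carrier A" using that sub by blast
    have "u \<otimes>\<^bsub>A\<^esub> z = u \<otimes>\<^bsub>A\<^esub> (b \<odot>\<^bsub>A\<^esub> \<one>\<^bsub>A\<^esub>) \<oplus>\<^bsub>A\<^esub> u \<otimes>\<^bsub>A\<^esub> \<xi>"
      unfolding z_def Lx using u b xi_closed by (intro A.r_distr) auto
    also have "u \<otimes>\<^bsub>A\<^esub> (b \<odot>\<^bsub>A\<^esub> \<one>\<^bsub>A\<^esub>) = b \<odot>\<^bsub>A\<^esub> u"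
      using A.smult_assoc2[of b "\<one>\<^bsub>A\<^esub>" u] u b A.m_comm[of u] by simp
    finally have "u \<otimes>\<^bsub>A\<^esub> \<xi> = (\<ominus>\<^bsub>k\<^esub> b) \<odot>\<^bsub>A\<^esub> u \<oplus>\<^bsub>A\<^esub> u \<otimes>\<^bsub>A\<^esub> z"
      using u b xi_closed by (simp add: A.smult_l_minus A.M.a_assoc[symmetric] A.M.l_neg)
    moreover have "u \<otimes>\<^bsub>A\<^esub> z \<in> A.power_span z n"
      using A.power_span_mult[OF z c] pow that unfolding m z_def by blast
    ultimately show ?thesis
      using A.power_span_add[OF z] A.power_span_smult[OF z _ that, of "\<ominus>\<^bsub>k\<^esub> b"] b by simp
  qed
  have one: "\<one>\<^bsub>A\<^esub> \<in> A.power_span z n"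
    using A.one_power_span[OF z, of m] by (simp add: m[symmetric])
  have W: "A.power_span z n = carrier A"
    by (rule xi_generates[OF sub A.power_span_add[OF z] A.power_span_smult[OF z] one Wxi])
  show "\<exists>a\<in>{..<n} \<rightarrow> carrier k. u = (\<Oplus>\<^bsub>A\<^esub>i\<in>{..<n}. a i \<odot>\<^bsub>A\<^esub> (poly_class L [^]\<^bsub>A\<^esub> i))"
    if "u \<in> carrier A" for u
    using that unfolding W[symmetric] A.power_span_def z_def by blast
  show "a i = \<zero>\<^bsub>k\<^esub>" if "a \<in> {..<n} \<rightarrow> carrier k"
    "(\<Oplus>\<^bsub>A\<^esub>i\<in>{..<n}. a i \<odot>\<^bsub>A\<^esub> (poly_class L [^]\<^bsub>A\<^esub> i)) = \<zero>\<^bsub>A\<^esub>" "i < n" for a i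
    using power_independent[OF L that] .
qed (fact c n_pos pow)+

end

section \<open>Two incompatible gradings in prime characteristic\<close>

context truncated_polynomials begin

lemma power_basis_xi: "power_basis k A \<xi> \<zero>\<^bsub>k\<^esub> n"
proof -
  have "\<xi> = \<zero>\<^bsub>k\<^esub> \<odot>\<^bsub>A\<^esub> \<one>\<^bsub>A\<^esub> \<oplus>\<^bsub>A\<^esub> \<xi>" "\<xi> [^]\<^bsub>A\<^esub> n = \<zero>\<^bsub>k\<^esub> \<odot>\<^bsub>A\<^esub> \<one>\<^bsub>A\<^esub>"
    using xi_closed xi_pow_n A.smult_l_null[OF A.one_closed] by (simp_all del: truncated_poly_simps)
  then show ?thesis
    using power_basis_linear[OF X_closed, of "\<zero>\<^bsub>k\<^esub>" "\<zero>\<^bsub>k\<^esub>"] unfolding \<xi>_def by (simp add: var_def del: truncated_poly_simps)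
qed

text \<open>
  By the Frobenius identity \<open>(1 + x)\<^sup>n = 1 + x\<^sup>n = 1\<close>: the algebra is also the group algebra of a
  cyclic group of order \<open>n\<close> generated by \<open>1 + x\<close>.
\<close>

lemma power_basis_one_plus_xi:
  assumes n: "Factorial_Ring.prime n" and char: "characteristic k = n"
  shows "power_basis k A (\<one>\<^bsub>A\<^esub> \<oplus>\<^bsub>A\<^esub> \<xi>) \<one>\<^bsub>k\<^esub> n"
proof -
  note [simp del] = truncated_poly_simps
  interpret h: ring_hom_ring P A poly_class by (rule class_ring_hom)
  define L where "L = X\<^bsub>k\<^esub> \<oplus>\<^bsub>P\<^esub> \<one>\<^bsub>P\<^esub>"
  have L: "L \<in> carrier P" using X_closed by (simp add: L_def)
  have "length L = max (length X\<^bsub>k\<^esub>) (length \<one>\<^bsub>P\<^esub>)"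
    unfolding L_def univ_poly_add
    by (rule poly_add_length_eq[OF carrier_is_subring])
      (use X_closed P.one_closed in \<open>auto simp: univ_poly_carrier var_def univ_poly_one\<close>)
  then have len: "length L = 2" by (simp add: var_def univ_poly_one)
  have cL: "poly_class L = \<one>\<^bsub>A\<^esub> \<oplus>\<^bsub>A\<^esub> \<xi>"
    unfolding L_def using X_closed xi_closed h.hom_add h.hom_one A.M.a_comm[of \<xi> "\<one>\<^bsub>A\<^esub>"]
    by (simp add: \<xi>_def)
  have "[n] \<cdot>\<^bsub>k\<^esub> \<one>\<^bsub>k\<^esub> = \<zero>\<^bsub>k\<^esub>"
    using add.pow_ord_eq_1[OF one_closed] char unfolding characteristic_def add_pow_def by simp
  moreover have "[m] \<cdot>\<^bsub>A\<^esub> \<one>\<^bsub>A\<^esub> = ([m] \<cdot>\<^bsub>k\<^esub> \<one>\<^bsub>k\<^esub>) \<odot>\<^bsub>A\<^esub> \<one>\<^bsub>A\<^esub>" for m :: nat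
    by (induction m) (simp_all add: A.smult_l_distr)
  ultimately have "[n] \<cdot>\<^bsub>A\<^esub> \<one>\<^bsub>A\<^esub> = \<zero>\<^bsub>A\<^esub>" by simp
  then have "(\<one>\<^bsub>A\<^esub> \<oplus>\<^bsub>A\<^esub> \<xi>) [^]\<^bsub>A\<^esub> n = \<one>\<^bsub>A\<^esub> \<oplus>\<^bsub>A\<^esub> \<xi> [^]\<^bsub>A\<^esub> n"
    by (rule cring.frobenius_one_add[OF cring_truncated xi_closed n])
  then have "(\<one>\<^bsub>A\<^esub> \<oplus>\<^bsub>A\<^esub> \<xi>) [^]\<^bsub>A\<^esub> n = \<one>\<^bsub>k\<^esub> \<odot>\<^bsub>A\<^esub> \<one>\<^bsub>A\<^esub>"
    by (simp add: xi_pow_n)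
  then show ?thesis
    using power_basis_linear[OF L len, of "\<one>\<^bsub>k\<^esub>" "\<one>\<^bsub>k\<^esub>"] by (simp add: cL)
qed

text \<open>
  For \<open>i > 0\<close> the \<open>n\<close>-th power of \<open>a x\<^sup>i\<close> is \<open>0\<close>, whereas that of \<open>b (1 + x)\<^sup>j\<close> is the scalar
  \<open>b\<^sup>n\<close>. An element of both forms thus has \<open>b = 0\<close> unless \<open>i = 0\<close>.
\<close>

lemma common_homogeneous_is_scalar:
  assumes n: "Factorial_Ring.prime n" and char: "characteristic k = n"
    and a: "a \<in> carrier k" and w: "w = a \<odot>\<^bsub>A\<^esub> (\<xi> [^]\<^bsub>A\<^esub> (i::nat))"
    and b: "b \<in> carrier k" and w': "w = b \<odot>\<^bsub>A\<^esub> ((\<one>\<^bsub>A\<^esub> \<oplus>\<^bsub>A\<^esub> \<xi>) [^]\<^bsub>A\<^esub> (j::nat))"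
  shows "w \<in> power_basis.power_line k A \<xi> 0"
proof -
  note [simp del] = truncated_poly_simps
  interpret x: power_basis k A \<xi> "\<zero>\<^bsub>k\<^esub>" n by (rule power_basis_xi)
  interpret y: power_basis k A "\<one>\<^bsub>A\<^esub> \<oplus>\<^bsub>A\<^esub> \<xi>" "\<one>\<^bsub>k\<^esub>" n by (rule power_basis_one_plus_xi[OF n char])
  show ?thesis
  proof (cases "i = 0")
    case True
    then show ?thesis using a w by (auto simp: x.power_line_def)
  next
    case False
    have "(\<xi> [^]\<^bsub>A\<^esub> i) [^]\<^bsub>A\<^esub> n = (\<xi> [^]\<^bsub>A\<^esub> n) [^]\<^bsub>A\<^esub> i"
      using xi_closed by (simp add: A.nat_pow_pow mult.commute)
    also have "\<dots> = \<zero>\<^bsub>A\<^esub>" using False by (simp add: xi_pow_n A.nat_pow_zero)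
    finally have "w [^]\<^bsub>A\<^esub> n = \<zero>\<^bsub>A\<^esub>"
      unfolding w using a x.z_pow_closed[of i] by (simp add: x.smult_pow)
    moreover have "((\<one>\<^bsub>A\<^esub> \<oplus>\<^bsub>A\<^esub> \<xi>) [^]\<^bsub>A\<^esub> j) [^]\<^bsub>A\<^esub> n = \<one>\<^bsub>A\<^esub>"
      using y.z_closed y.z_pow by (simp add: A.nat_pow_pow A.nat_pow_pow[symmetric] mult.commute[of j])
    then have "w [^]\<^bsub>A\<^esub> n = (b [^]\<^bsub>k\<^esub> n) \<odot>\<^bsub>A\<^esub> \<one>\<^bsub>A\<^esub>"
      unfolding w' using b y.z_pow_closed[of j] by (simp add: y.smult_pow)
    ultimately have "b = \<zero>\<^bsub>k\<^esub>" using x.scalar_pow_eq_zero[OF b] by simp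
    then have "w = \<zero>\<^bsub>k\<^esub> \<odot>\<^bsub>A\<^esub> (\<xi> [^]\<^bsub>A\<^esub> nat 0)"
      unfolding w' using y.z_pow_closed[of j] by simp
    then show ?thesis unfolding x.power_line_def by blast
  qed
qed

text \<open>
  A scalar that is nilpotent is zero, but \<open>x\<close> is nilpotent and, for \<open>n > 1\<close>, nonzero.
\<close>

lemma xi_not_scalar:
  assumes n: "1 < n"
  shows "\<xi> \<notin> power_basis.power_line k A \<xi> 0"
proof
  note [simp del] = truncated_poly_simps
  interpret x: power_basis k A \<xi> "\<zero>\<^bsub>k\<^esub>" n by (rule power_basis_xi)
  assume "\<xi> \<in> x.power_line 0"
  then obtain a where a: "a \<in> carrier k" "\<xi> = a \<odot>\<^bsub>A\<^esub> \<one>\<^bsub>A\<^esub>" by (auto simp: x.power_line_def)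
  have "(a [^]\<^bsub>k\<^esub> n) \<odot>\<^bsub>A\<^esub> \<one>\<^bsub>A\<^esub> = \<zero>\<^bsub>A\<^esub>"
    using x.smult_pow[OF a(1) A.one_closed, of n] xi_pow_n unfolding a(2)[symmetric] by simp
  then have "a = \<zero>\<^bsub>k\<^esub>" by (rule x.scalar_pow_eq_zero[OF a(1)])
  then have "\<xi> = \<zero>\<^bsub>A\<^esub>" using a(2) A.smult_l_null[OF A.one_closed] by simp
  then show False using x.power_nonzero[OF n] xi_closed by simp
qed

end

theorem proposition5p3:
  fixes k :: "('a, 's) ring_scheme" and p :: nat
  assumes "field k" and "Factorial_Ring.prime p" and "characteristic k = p"
    and "infinite (UNIV :: 'o set)"
    and "\<exists>e :: 'a list set \<Rightarrow> 'm. inj_on e (carrier (truncated_poly k p))"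
  shows "\<not> (\<exists>(U :: ('a, 'u, 'n) kcat) P.
    universal_covering TYPE('o) TYPE('m) k U (one_object_kcat (truncated_poly k p)) P)"
proof
  assume "\<exists>(U :: ('a, 'u, 'n) kcat) P.
    universal_covering TYPE('o) TYPE('m) k U (one_object_kcat (truncated_poly k p)) P"
  then obtain U :: "('a, 'u, 'n) kcat" and P
    where U: "universal_covering TYPE('o) TYPE('m) k U (one_object_kcat (truncated_poly k p)) P" by blast
  obtain e :: "'a list set \<Rightarrow> 'm" where e: "inj_on e (carrier (truncated_poly k p))"
    using assms(5) by blast
  interpret T: truncated_polynomials k p
    using assms(1,2) prime_gt_0_nat by (intro truncated_polynomials.intro truncated_polynomials_axioms.intro)
  \<comment> \<open>The scalars, as the component of degree \<open>0\<close> of the grading by powers of \<open>x\<close>.\<close>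
  let ?W = "power_basis.power_line k (truncated_poly k p) T.\<xi> 0"
  note x = T.power_basis_xi and y = T.power_basis_one_plus_xi[OF assms(2,3)]
  have "?W = carrier (truncated_poly k p)"
  proof (rule covering_image_spans[OF T.algebra_truncated])
    show "covering k U (one_object_kcat (truncated_poly k p)) P"
      using U unfolding universal_covering_def galois_covering_def by blast
    show "submodule ?W k (truncated_poly k p)" by (rule power_basis.power_line_submodule[OF x])
    fix u v f assume f: "u \<in> Ob U" "v \<in> Ob U" "f \<in> carrier (Hom U u v)"
    \<comment> \<open>The universal property is applied twice, to the coverings given by the two gradings.\<close>
    show "FHom P u v f \<in> ?W"
      using power_basis.universal_covering_in_power_line[OF x assms(4) e U f]
        power_basis.universal_covering_in_power_line[OF y assms(4) e U f]
        T.common_homogeneous_is_scalar[OF assms(2,3)] by blast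
  qed
  then show False
    using T.xi_closed T.xi_not_scalar[OF prime_gt_1_nat[OF assms(2)]] by blast
qed

end
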